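(* Consider a finite MDP with tabular softmax policies, an initial state distribution $\mu$ with $\min_s\mu(s)>0$, another state distribution $\rho$, and suppose every state $s$ has a unique optimal action $a^*(s)$; let $\pi^*$ be the deterministic optimal policy choosing $a^*(s)$ and $V^*=V^{\pi^*}$. Let $C_\infty:=\max_\pi\|d_\mu^\pi/\mu\|_\infty$, $C'_\infty:=\max_\pi\|d_\rho^\pi/\mu\|_\infty$, and let $\{\theta_t\}$ be generated by $\theta_{t+1}=\theta_t+\eta\,\frac{\partial V^{\pi_{\theta_t}}(\mu)}{\partial\theta_t}\Big/\Big\|\frac{\partial V^{\pi_{\theta_t}}(\mu)}{\partial\theta_t}\Big\|_2$ with $\eta=\frac{1-\gamma}{6(1-\gamma)+8(C_\infty-(1-\gamma))}\cdot\frac{1}{\sqrt S}$. Let $c:=\inf_{s,t\ge1}\pi_{\theta_t}(a^*(s)|s)$ (which is positive). Then for all $t\ge1$, $$V^*(\rho)-V^{\pi_{\theta_t}}(\rho)\le\frac{\big(V^*(\mu)-V^{\pi_{\theta_1}}(\mu)\big)C'_\infty}{1-\gamma}\,e^{-C(t-1)},\qquad C=\frac{(1-\gamma)^2c}{12(1-\gamma)+16(C_\infty-(1-\gamma))}\cdot\frac1S\cdot\Big\|\frac{d_\mu^{\pi^*}}{\mu}\Big\|_\infty^{-1}.$$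
   Context: A finite MDP $(\mathcal{S},\mathcal{A},\mathcal{P},r,\gamma)$ with $S=|\mathcal{S}|$, rewards in $[0,1]$, $\gamma\in[0,1)$. $V^\pi(s)$ is the expected discounted return from $s$ under $\pi$, $V^\pi(\nu)=\sum_s\nu(s)V^\pi(s)$, $Q^\pi(s,a)=r(s,a)+\gamma\sum_{s'}\mathcal{P}(s'|s,a)V^\pi(s')$, $Q^*=Q^{\pi^*}$; $d_\nu^\pi(s)=(1-\gamma)\sum_{t\ge0}\gamma^t\Pr(s_t=s\mid s_0\sim\nu,\pi,\mathcal{P})$. Tabular softmax policy: $\pi_\theta(a|s)=e^{\theta(s,a)}/\sum_{a'}e^{\theta(s,a')}$. *)

theory Defs
  imports "HOL-Analysis.Analysis"
begin

text \<open>Finite MDP with state type 's and action type 'a (both finite).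
  Transition kernel P s a s' = P(s'|s,a), reward r s a, discount g.
  A (stochastic) policy is pol :: 's => 'a => real with pol s a = pol(a|s).\<close>

definition is_mdp :: "('s::finite \<Rightarrow> 'a::finite \<Rightarrow> 's \<Rightarrow> real) \<Rightarrow> ('s \<Rightarrow> 'a \<Rightarrow> real) \<Rightarrow> real \<Rightarrow> bool" where
  "is_mdp P r g \<longleftrightarrow>
     (\<forall>s a s'. 0 \<le> P s a s') \<and> (\<forall>s a. (\<Sum>s'\<in>UNIV. P s a s') = 1) \<and>
     (\<forall>s a. 0 \<le> r s a \<and> r s a \<le> 1) \<and> 0 \<le> g \<and> g < 1"

definition is_policy :: "('s::finite \<Rightarrow> 'a::finite \<Rightarrow> real) \<Rightarrow> bool" where
  "is_policy pol \<longleftrightarrow> (\<forall>s a. 0 \<le> pol s a) \<and> (\<forall>s. (\<Sum>a\<in>UNIV. pol s a) = 1)"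

definition is_distr :: "('s::finite \<Rightarrow> real) \<Rightarrow> bool" where
  "is_distr nu \<longleftrightarrow> (\<forall>s. 0 \<le> nu s) \<and> (\<Sum>s\<in>UNIV. nu s) = 1"

definition Ppi :: "('s::finite \<Rightarrow> 'a::finite \<Rightarrow> 's \<Rightarrow> real) \<Rightarrow> ('s \<Rightarrow> 'a \<Rightarrow> real) \<Rightarrow> 's \<Rightarrow> 's \<Rightarrow> real" where
  "Ppi P pol s s' = (\<Sum>a\<in>UNIV. pol s a * P s a s')"

text \<open>Pt P pol t s s' = Pr(s_t = s' | s_0 = s, pol, P).\<close>
fun Pt :: "('s::finite \<Rightarrow> 'a::finite \<Rightarrow> 's \<Rightarrow> real) \<Rightarrow> ('s \<Rightarrow> 'a \<Rightarrow> real) \<Rightarrow> nat \<Rightarrow> 's \<Rightarrow> 's \<Rightarrow> real" where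
  "Pt P pol 0 s s' = (if s = s' then 1 else 0)"
| "Pt P pol (Suc t) s s' = (\<Sum>s''\<in>UNIV. Pt P pol t s s'' * Ppi P pol s'' s')"

definition Vfun :: "('s::finite \<Rightarrow> 'a::finite \<Rightarrow> 's \<Rightarrow> real) \<Rightarrow> ('s \<Rightarrow> 'a \<Rightarrow> real) \<Rightarrow> real \<Rightarrow> ('s \<Rightarrow> 'a \<Rightarrow> real) \<Rightarrow> 's \<Rightarrow> real" where
  "Vfun P r g pol s = (\<Sum>t. g ^ t * (\<Sum>s'\<in>UNIV. Pt P pol t s s' * (\<Sum>a\<in>UNIV. pol s' a * r s' a)))"

definition Vdist :: "('s::finite \<Rightarrow> 'a::finite \<Rightarrow> 's \<Rightarrow> real) \<Rightarrow> ('s \<Rightarrow> 'a \<Rightarrow> real) \<Rightarrow> real \<Rightarrow> ('s \<Rightarrow> 'a \<Rightarrow> real) \<Rightarrow> ('s \<Rightarrow> real) \<Rightarrow> real" where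
  "Vdist P r g pol nu = (\<Sum>s\<in>UNIV. nu s * Vfun P r g pol s)"

definition Qfun :: "('s::finite \<Rightarrow> 'a::finite \<Rightarrow> 's \<Rightarrow> real) \<Rightarrow> ('s \<Rightarrow> 'a \<Rightarrow> real) \<Rightarrow> real \<Rightarrow> ('s \<Rightarrow> 'a \<Rightarrow> real) \<Rightarrow> 's \<Rightarrow> 'a \<Rightarrow> real" where
  "Qfun P r g pol s a = r s a + g * (\<Sum>s'\<in>UNIV. P s a s' * Vfun P r g pol s')"

definition dvisit :: "('s::finite \<Rightarrow> 'a::finite \<Rightarrow> 's \<Rightarrow> real) \<Rightarrow> real \<Rightarrow> ('s \<Rightarrow> 'a \<Rightarrow> real) \<Rightarrow> ('s \<Rightarrow> real) \<Rightarrow> 's \<Rightarrow> real" where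
  "dvisit P g pol nu s = (1 - g) * (\<Sum>t. g ^ t * (\<Sum>s0\<in>UNIV. nu s0 * Pt P pol t s0 s))"

definition ratio_inf :: "('s::finite \<Rightarrow> real) \<Rightarrow> ('s \<Rightarrow> real) \<Rightarrow> real" where
  "ratio_inf d mu = Max (range (\<lambda>s. \<bar>d s / mu s\<bar>))"

definition softmax :: "('s \<times> 'a::finite \<Rightarrow> real) \<Rightarrow> 's \<Rightarrow> 'a \<Rightarrow> real" where
  "softmax theta s a = exp (theta (s, a)) / (\<Sum>a'\<in>UNIV. exp (theta (s, a')))"

definition gradV :: "('s::finite \<Rightarrow> 'a::finite \<Rightarrow> 's \<Rightarrow> real) \<Rightarrow> ('s \<Rightarrow> 'a \<Rightarrow> real) \<Rightarrow> real \<Rightarrow> ('s \<Rightarrow> real) \<Rightarrow> ('s \<times> 'a \<Rightarrow> real) \<Rightarrow> 's \<times> 'a \<Rightarrow> real" where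
  "gradV P r g mu theta p = deriv (\<lambda>x. Vdist P r g (softmax (theta(p := x))) mu) (theta p)"

definition l2norm :: "('i::finite \<Rightarrow> real) \<Rightarrow> real" where
  "l2norm v = sqrt (\<Sum>i\<in>UNIV. (v i)^2)"

end

theory Submission
  imports Defs
begin

text \<open>
  The Hessian of the objective is bounded, as a bilinear form, by \<open>3 + 4 k\<close> times the norm of the
  gradient itself, where \<open>1 + k = Cinf / (1 - g)\<close>. With the prescribed step length the gradient
  norm therefore at most doubles along an update, and each update gains at least half of
  \<open>eta\<close> times the gradient norm. Combined with the gradient domination inequality this contracts
  the suboptimality gap by \<open>1 - C\<close>, and a change of measure passes from \<open>mu\<close> to \<open>rho\<close>.

  For \<open>c > 0\<close>: the values increase at every state, so advantages converge, and the gradient tends to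
  zero. An analysis of the logits at a single state shows that no limiting advantage is positive;
  hence the limit is optimal and, optimal actions being unique, their probabilities tend to 1.
\<close>

section \<open>Occupancies and value functions\<close>

locale discounted_mdp =
  fixes P :: "'s::finite \<Rightarrow> 'a::finite \<Rightarrow> 's \<Rightarrow> real" and g :: real
  assumes P_nonneg: "0 \<le> P s a s'"
    and P_sum: "(\<Sum>s'\<in>UNIV. P s a s') = 1"
    and g_nonneg: "0 \<le> g"
    and g_less: "g < 1"
begin

text \<open>Occupancies without the factor \<open>1 - g\<close> of \<open>dvisit\<close>, so that \<open>occ pol\<close> is the inverse matrix
  of \<open>I - g * Ppi P pol\<close>.\<close>

definition occ :: "('s \<Rightarrow> 'a \<Rightarrow> real) \<Rightarrow> 's \<Rightarrow> 's \<Rightarrow> real" where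
  "occ pol s s' = (\<Sum>t. g ^ t * Pt P pol t s s')"

definition occd :: "('s \<Rightarrow> 'a \<Rightarrow> real) \<Rightarrow> ('s \<Rightarrow> real) \<Rightarrow> 's \<Rightarrow> real" where
  "occd pol nu s = (\<Sum>s0\<in>UNIV. nu s0 * occ pol s0 s)"

context
  fixes pol :: "'s \<Rightarrow> 'a \<Rightarrow> real"
  assumes pol: "is_policy pol"
begin

lemma pol_nonneg: "0 \<le> pol s a" and pol_sum: "(\<Sum>a\<in>UNIV. pol s a) = 1"
  using pol by (auto simp: is_policy_def)

lemma Ppi_nonneg: "0 \<le> Ppi P pol s s'"
  unfolding Ppi_def by (intro sum_nonneg mult_nonneg_nonneg pol_nonneg P_nonneg)

lemma Ppi_sum: "(\<Sum>s'\<in>UNIV. Ppi P pol s s') = 1"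
  unfolding Ppi_def
  by (subst sum.swap) (simp add: sum_distrib_left[symmetric] P_sum pol_sum)

lemma Pt_nonneg: "0 \<le> Pt P pol t s s'"
  by (induction t arbitrary: s') (auto intro!: sum_nonneg mult_nonneg_nonneg Ppi_nonneg)

lemma Pt_sum: "(\<Sum>s'\<in>UNIV. Pt P pol t s s') = 1"
proof (induction t)
  case (Suc t)
  then show ?case
    by (simp, subst sum.swap) (simp add: sum_distrib_left[symmetric] Ppi_sum)
qed simp

lemma Pt_le_1: "Pt P pol t s s' \<le> 1"
  using member_le_sum[of s' UNIV "Pt P pol t s"] by (simp add: Pt_nonneg Pt_sum)

lemma Pt_Suc_left: "Pt P pol (Suc t) s s' = (\<Sum>u\<in>UNIV. Ppi P pol s u * Pt P pol t u s')"
proof (induction t arbitrary: s')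
  case 0
  have "(\<Sum>v\<in>UNIV. (if s = v then 1 else 0) * Ppi P pol v s') = Ppi P pol s s'"
    using sum.delta[of UNIV s "\<lambda>v. Ppi P pol v s'"] by (simp add: if_distrib[of "\<lambda>x. x * _"] cong: if_cong)
  moreover have "(\<Sum>u\<in>UNIV. Ppi P pol s u * (if u = s' then 1 else 0)) = Ppi P pol s s'"
    by (simp add: if_distrib[of "\<lambda>x. _ * x"] cong: if_cong)
  ultimately show ?case by simp
next
  case (Suc t)
  have "Pt P pol (Suc (Suc t)) s s' = (\<Sum>v\<in>UNIV. (\<Sum>u\<in>UNIV. Ppi P pol s u * Pt P pol t u v) * Ppi P pol v s')"
    by (subst Pt.simps(2)) (simp only: Suc)
  also have "\<dots> = (\<Sum>u\<in>UNIV. Ppi P pol s u * Pt P pol (Suc t) u s')"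
    by (simp add: sum_distrib_right sum_distrib_left mult.assoc) (rule sum.swap)
  finally show ?case .
qed

lemma summable_Pt: "summable (\<lambda>t. g ^ t * Pt P pol t s s')"
proof (rule summable_comparison_test)
  show "summable (\<lambda>t. g ^ t)" using g_nonneg g_less by (simp add: summable_geometric)
  show "\<exists>N. \<forall>n\<ge>N. norm (g ^ n * Pt P pol n s s') \<le> g ^ n"
    using g_nonneg Pt_nonneg Pt_le_1 by (auto simp: abs_mult intro!: mult_left_le)
qed

lemma occ_nonneg: "0 \<le> occ pol s s'"
  unfolding occ_def by (intro suminf_nonneg summable_Pt mult_nonneg_nonneg) (auto simp: g_nonneg Pt_nonneg)

lemma occ_le: "occ pol s s' \<le> 1 / (1 - g)"
proof -
  have "occ pol s s' \<le> (\<Sum>t. g ^ t)"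
    unfolding occ_def using g_nonneg g_less Pt_le_1 Pt_nonneg
    by (intro suminf_le summable_Pt) (auto intro!: mult_left_le summable_geometric)
  then show ?thesis using g_nonneg g_less by (simp add: suminf_geometric)
qed

lemma occ_Suc: "occ pol s s' = (if s = s' then 1 else 0) + g * (\<Sum>t. g ^ t * Pt P pol (Suc t) s s')"
proof -
  have "summable (\<lambda>t. g ^ Suc t * Pt P pol (Suc t) s s')"
    using summable_Pt by (subst summable_Suc_iff)
  then have sm: "summable (\<lambda>t. g * (g ^ t * Pt P pol (Suc t) s s'))"
    by (simp add: mult.assoc del: Pt.simps)
  have "occ pol s s' = g ^ 0 * Pt P pol 0 s s' + (\<Sum>t. g ^ Suc t * Pt P pol (Suc t) s s')"
    unfolding occ_def by (subst suminf_split_head[OF summable_Pt]) simp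
  \<comment> \<open>Summability without the extra factor is obtained by cancelling \<open>g\<close>,
    so \<open>g = 0\<close> is treated apart; there both sides vanish.\<close>
  also have "(\<Sum>t. g ^ Suc t * Pt P pol (Suc t) s s') = g * (\<Sum>t. g ^ t * Pt P pol (Suc t) s s')"
  proof (cases "g = 0")
    case False
    then have "summable (\<lambda>t. g ^ t * Pt P pol (Suc t) s s')"
      using sm by (simp add: summable_cmult_iff del: Pt.simps)
    then show ?thesis by (simp add: mult.assoc suminf_mult del: Pt.simps)
  qed simp
  finally show ?thesis by simp
qed

lemma occ_right: "occ pol s s' = (if s = s' then 1 else 0) + g * (\<Sum>u\<in>UNIV. occ pol s u * Ppi P pol u s')"
proof -
  have "(\<Sum>t. g ^ t * Pt P pol (Suc t) s s') = (\<Sum>t. \<Sum>u\<in>UNIV. g ^ t * Pt P pol t s u * Ppi P pol u s')"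
    by (simp add: sum_distrib_left mult.assoc)
  also have "\<dots> = (\<Sum>u\<in>UNIV. occ pol s u * Ppi P pol u s')"
    unfolding occ_def by (subst suminf_sum) (auto intro!: summable_mult2 summable_Pt sum.cong suminf_mult2[symmetric])
  finally show ?thesis using occ_Suc by metis
qed

lemma occ_left: "occ pol s s' = (if s = s' then 1 else 0) + g * (\<Sum>u\<in>UNIV. Ppi P pol s u * occ pol u s')"
proof -
  have "(\<Sum>t. g ^ t * Pt P pol (Suc t) s s') = (\<Sum>t. \<Sum>u\<in>UNIV. Ppi P pol s u * (g ^ t * Pt P pol t u s'))"
    by (simp add: sum_distrib_left mult_ac Pt_Suc_left del: Pt.simps)
  also have "\<dots> = (\<Sum>u\<in>UNIV. Ppi P pol s u * occ pol u s')"
    unfolding occ_def by (subst suminf_sum) (auto intro!: summable_mult summable_Pt sum.cong suminf_mult)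
  finally show ?thesis using occ_Suc by metis
qed

lemma Vfun_occ: "Vfun P r g pol s = (\<Sum>s'\<in>UNIV. occ pol s s' * (\<Sum>a\<in>UNIV. pol s' a * r s' a))"
proof -
  have "Vfun P r g pol s = (\<Sum>t. \<Sum>s'\<in>UNIV. g ^ t * Pt P pol t s s' * (\<Sum>a\<in>UNIV. pol s' a * r s' a))"
    unfolding Vfun_def by (simp add: sum_distrib_left mult.assoc)
  also have "\<dots> = (\<Sum>s'\<in>UNIV. occ pol s s' * (\<Sum>a\<in>UNIV. pol s' a * r s' a))"
    unfolding occ_def by (subst suminf_sum) (auto intro!: summable_mult2 summable_Pt sum.cong suminf_mult2[symmetric])
  finally show ?thesis .
qed

lemma sum_pol_Qfun:
  assumes pol2: "is_policy pol2"
  shows "(\<Sum>a\<in>UNIV. pol s a * Qfun P r g pol2 s a)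
    = (\<Sum>a\<in>UNIV. pol s a * r s a) + g * (\<Sum>u\<in>UNIV. Ppi P pol s u * Vfun P r g pol2 u)"
  unfolding Qfun_def Ppi_def
  apply (simp add: distrib_left sum.distrib sum_distrib_left sum_distrib_right mult_ac)
  apply (subst sum.swap)
  apply simp
  done

lemma sum_delta_mult: "(\<Sum>u\<in>UNIV. (if s = u then 1 else 0) * f u) = (f (s::'s)::real)"
  using sum.delta[of UNIV s f] by (simp add: if_distrib[of "\<lambda>x. x * _"] cong: if_cong)

lemma Vfun_Bellman: "Vfun P r g pol s = (\<Sum>a\<in>UNIV. pol s a * Qfun P r g pol s a)"
proof -
  let ?R = "\<lambda>s'. (\<Sum>a\<in>UNIV. pol s' a * r s' a)"
  have "Vfun P r g pol s = (\<Sum>s'\<in>UNIV. (if s = s' then 1 else 0) * ?R s')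
      + (\<Sum>s'\<in>UNIV. g * (\<Sum>u\<in>UNIV. Ppi P pol s u * occ pol u s') * ?R s')"
    unfolding Vfun_occ by (subst occ_left) (simp only: distrib_right sum.distrib)
  also have "(\<Sum>s'\<in>UNIV. g * (\<Sum>u\<in>UNIV. Ppi P pol s u * occ pol u s') * ?R s')
     = g * (\<Sum>u\<in>UNIV. Ppi P pol s u * Vfun P r g pol u)"
    unfolding Vfun_occ sum_distrib_left[of g] sum_distrib_right sum_distrib_left[of "Ppi P pol s _"]
    by (subst sum.swap) (simp add: sum_distrib_left sum_distrib_right mult_ac)
  finally show ?thesis unfolding sum_pol_Qfun[OF pol] sum_delta_mult .
qed

text \<open>This is the matrix identity \<open>occ * (I - g * Ppi) = I\<close> applied to
  \<open>f\<close>; its use is with \<open>f\<close> the value function of another policy.\<close>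

lemma occ_resolvent: "f s = (\<Sum>u\<in>UNIV. occ pol s u * (f u - g * (\<Sum>v\<in>UNIV. Ppi P pol u v * f v)))"
proof -
  have "(\<Sum>u\<in>UNIV. occ pol s u * f u) = (\<Sum>u\<in>UNIV. (if s = u then 1 else 0) * f u)
      + (\<Sum>v\<in>UNIV. g * (\<Sum>u\<in>UNIV. occ pol s u * Ppi P pol u v) * f v)"
    by (subst occ_right) (simp only: distrib_right sum.distrib)
  also have "(\<Sum>v\<in>UNIV. g * (\<Sum>u\<in>UNIV. occ pol s u * Ppi P pol u v) * f v)
      = (\<Sum>u\<in>UNIV. occ pol s u * (g * (\<Sum>v\<in>UNIV. Ppi P pol u v * f v)))"
    unfolding sum_distrib_left sum_distrib_right by (subst sum.swap) (simp add: mult_ac)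
  finally show ?thesis unfolding sum_delta_mult by (simp add: right_diff_distrib sum_subtractf)
qed

text \<open>Both values are written against the occupancy of \<open>pol\<close>, its own by
  \<open>Vfun_occ\<close> and that of \<open>pol2\<close> by \<open>occ_resolvent\<close>. What
  remains is the one-step Bellman discrepancy of \<open>pol2\<close> under
  \<open>pol\<close>.\<close>

lemma performance_difference:
  assumes pol2: "is_policy pol2"
  shows "Vfun P r g pol s - Vfun P r g pol2 s
    = (\<Sum>u\<in>UNIV. occ pol s u * (\<Sum>a\<in>UNIV. pol u a * (Qfun P r g pol2 u a - Vfun P r g pol2 u)))"
proof -
  have *: "(\<Sum>a\<in>UNIV. pol u a * (Qfun P r g pol2 u a - Vfun P r g pol2 u))
     = (\<Sum>a\<in>UNIV. pol u a * r u a)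
       - (Vfun P r g pol2 u - g * (\<Sum>v\<in>UNIV. Ppi P pol u v * Vfun P r g pol2 v))" for u
    by (simp add: right_diff_distrib sum_subtractf sum_pol_Qfun[OF pol2] sum_distrib_right[symmetric] pol_sum)
  show ?thesis
    unfolding * right_diff_distrib[of "occ pol s _"] sum_subtractf Vfun_occ[of r s, symmetric]
    by (subst occ_resolvent[of "Vfun P r g pol2"]) (simp add: right_diff_distrib sum_subtractf)
qed

end

lemma performance_difference':
  assumes "is_policy pol" "is_policy pol2"
  shows "Vfun P r g pol s - Vfun P r g pol2 s
    = (\<Sum>u\<in>UNIV. occ pol s u * (\<Sum>a\<in>UNIV. (pol u a - pol2 u a) * Qfun P r g pol2 u a))"
  unfolding performance_difference[OF assms]
  by (simp add: right_diff_distrib left_diff_distrib sum_subtractf sum_distrib_right[symmetric]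
      pol_sum[OF assms(1)] Vfun_Bellman[OF assms(2), symmetric])

text \<open>The infinite series is never differentiated. Performance differences first give
  continuity, because occupancies are bounded by \<open>1 / (1 - g)\<close> uniformly in the policy,
  and then an exact expression for the difference quotient.\<close>

lemma Vfun_has_derivative:
  fixes pol :: "real \<Rightarrow> 's \<Rightarrow> 'a \<Rightarrow> real"
  assumes pol: "\<And>x. is_policy (pol x)"
    and d: "\<And>s a. ((\<lambda>x. pol x s a) has_real_derivative pol' s a) (at x)"
  shows "((\<lambda>x. Vfun P r g (pol x) s) has_real_derivative
     (\<Sum>u\<in>UNIV. occ (pol x) s u * (\<Sum>a\<in>UNIV. pol' u a * Qfun P r g (pol x) u a))) (at x)"
proof -
  have cp: "((\<lambda>y. pol y s a) \<longlongrightarrow> pol x s a) (at x)" for s a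
    using DERIV_isCont[OF d] by (simp add: isCont_def)
  have cV: "((\<lambda>y. Vfun P r g (pol y) s) \<longlongrightarrow> Vfun P r g (pol x) s) (at x)" for s
  proof -
    have t0: "((\<lambda>y. \<Sum>u\<in>UNIV. 1 / (1 - g) * (\<Sum>a\<in>UNIV. \<bar>pol y u a - pol x u a\<bar> * \<bar>Qfun P r g (pol x) u a\<bar>))
        \<longlongrightarrow> (\<Sum>u\<in>(UNIV::'s set). 1 / (1 - g) * (\<Sum>a\<in>(UNIV::'a set). \<bar>pol x u a - pol x u a\<bar> * \<bar>Qfun P r g (pol x) u a\<bar>))) (at x)"
      by (intro tendsto_intros cp)
    have "((\<lambda>y. Vfun P r g (pol y) s - Vfun P r g (pol x) s) \<longlongrightarrow> 0) (at x)"
    proof (rule Lim_null_comparison)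
      show "\<forall>\<^sub>F y in at x. norm (Vfun P r g (pol y) s - Vfun P r g (pol x) s) \<le>
        (\<Sum>u\<in>UNIV. 1 / (1 - g) * (\<Sum>a\<in>UNIV. \<bar>pol y u a - pol x u a\<bar> * \<bar>Qfun P r g (pol x) u a\<bar>))"
      proof (intro always_eventually allI)
        fix y
        have "\<bar>occ (pol y) s u * (\<Sum>a\<in>UNIV. (pol y u a - pol x u a) * Qfun P r g (pol x) u a)\<bar>
          \<le> 1 / (1 - g) * (\<Sum>a\<in>UNIV. \<bar>pol y u a - pol x u a\<bar> * \<bar>Qfun P r g (pol x) u a\<bar>)" for u
          unfolding abs_mult[of "occ (pol y) s u"]
        proof (rule mult_mono)
          show "\<bar>occ (pol y) s u\<bar> \<le> 1 / (1 - g)" using occ_le[OF pol] occ_nonneg[OF pol] by simp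
          show "\<bar>\<Sum>a\<in>UNIV. (pol y u a - pol x u a) * Qfun P r g (pol x) u a\<bar>
            \<le> (\<Sum>a\<in>UNIV. \<bar>pol y u a - pol x u a\<bar> * \<bar>Qfun P r g (pol x) u a\<bar>)"
            by (rule order.trans[OF sum_abs]) (simp add: abs_mult)
        qed (use g_less in auto)
        then show "norm (Vfun P r g (pol y) s - Vfun P r g (pol x) s) \<le>
          (\<Sum>u\<in>UNIV. 1 / (1 - g) * (\<Sum>a\<in>UNIV. \<bar>pol y u a - pol x u a\<bar> * \<bar>Qfun P r g (pol x) u a\<bar>))"
          unfolding performance_difference'[OF pol pol] real_norm_def
          by (intro order.trans[OF sum_abs] sum_mono)
      qed
    qed (use t0 in simp)
    then show ?thesis by (rule LIM_zero_cancel)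
  qed
  have cQ: "((\<lambda>y. Qfun P r g (pol y) s a) \<longlongrightarrow> Qfun P r g (pol x) s a) (at x)" for s a
    unfolding Qfun_def by (intro tendsto_intros cV)
  \<comment> \<open>Exchanging the two policies freezes the occupancy at \<open>x\<close> and lets
    only \<open>Qfun\<close> move with \<open>y\<close>, so continuity of the occupancy is not
    called for.\<close>
  have swap: "Vfun P r g (pol y) s - Vfun P r g (pol x) s
      = (\<Sum>u\<in>UNIV. occ (pol x) s u * (\<Sum>a\<in>UNIV. (pol y u a - pol x u a) * Qfun P r g (pol y) u a))" for y
    using performance_difference'[OF pol pol, of r x s y]
    by (simp add: left_diff_distrib right_diff_distrib sum_subtractf)
  have q: "((\<lambda>y. (pol y s a - pol x s a) / (y - x)) \<longlongrightarrow> pol' s a) (at x)" for s a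
    using d by (simp add: has_field_derivative_iff)
  have "(\<lambda>y. (Vfun P r g (pol y) s - Vfun P r g (pol x) s) / (y - x))
      = (\<lambda>y. \<Sum>u\<in>UNIV. occ (pol x) s u *
          (\<Sum>a\<in>UNIV. (pol y u a - pol x u a) / (y - x) * Qfun P r g (pol y) u a))"
    unfolding swap by (simp add: sum_divide_distrib sum_distrib_left)
  then show ?thesis
    unfolding has_field_derivative_iff by (simp only:) (intro tendsto_intros q cQ)
qed

text \<open>Occupancies are values for an indicator reward, so they inherit differentiability in the policy
  from \<open>Vfun_has_derivative\<close>.\<close>

lemma occ_Vfun:
  assumes "is_policy pol"
  shows "occ pol s u = Vfun P (\<lambda>s' a. if s' = u then 1 else 0) g pol s"
  unfolding Vfun_occ[OF assms] sum_distrib_right[symmetric] pol_sum[OF assms]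
  by (simp add: if_distrib cong: if_cong)

lemma dvisit_occd:
  assumes "is_policy pol"
  shows "dvisit P g pol nu s = (1 - g) * occd pol nu s"
proof -
  have "(\<Sum>t. g ^ t * (\<Sum>s0\<in>UNIV. nu s0 * Pt P pol t s0 s)) = (\<Sum>t. \<Sum>s0\<in>UNIV. nu s0 * (g ^ t * Pt P pol t s0 s))"
    by (simp add: sum_distrib_left mult_ac)
  also have "\<dots> = occd pol nu s"
    unfolding occd_def occ_def
    by (subst suminf_sum) (auto intro!: summable_mult summable_Pt[OF assms] sum.cong suminf_mult)
  finally show ?thesis by (simp add: dvisit_def)
qed

lemma occd_ge:
  assumes "is_policy pol" "\<And>s. 0 \<le> nu s"
  shows "nu s \<le> occd pol nu s"
proof -
  have "1 \<le> occ pol s s"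
    using occ_left[OF assms(1), of s s] g_nonneg
    by (simp add: sum_nonneg Ppi_nonneg[OF assms(1)] occ_nonneg[OF assms(1)])
  then have "nu s \<le> nu s * occ pol s s" using assms(2)[of s] by (simp add: mult_le_cancel_left1)
  also have "\<dots> \<le> occd pol nu s"
    unfolding occd_def
    by (rule member_le_sum) (auto simp: assms occ_nonneg)
  finally show ?thesis .
qed

text \<open>The flow balance of the discounted chain. It identifies the occupancy pushed forward by
  one discounted step with \<open>occd pol nu - nu\<close>, the source of the subtracted
  \<open>1 - g\<close> in the step length.\<close>

lemma occd_right:
  assumes "is_policy pol"
  shows "occd pol nu s = nu s + g * (\<Sum>u\<in>UNIV. occd pol nu u * Ppi P pol u s)"
proof -
  have "occd pol nu s = (\<Sum>s0\<in>UNIV. nu s0 * (if s0 = s then 1 else 0))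
      + (\<Sum>s0\<in>UNIV. nu s0 * (g * (\<Sum>u\<in>UNIV. occ pol s0 u * Ppi P pol u s)))"
    unfolding occd_def by (subst occ_right[OF assms]) (simp only: distrib_left sum.distrib)
  also have "(\<Sum>s0\<in>UNIV. nu s0 * (if s0 = s then 1 else 0)) = nu s"
    by (simp add: if_distrib cong: if_cong)
  also have "(\<Sum>s0\<in>UNIV. nu s0 * (g * (\<Sum>u\<in>UNIV. occ pol s0 u * Ppi P pol u s)))
     = g * (\<Sum>u\<in>UNIV. occd pol nu u * Ppi P pol u s)"
    unfolding occd_def sum_distrib_left sum_distrib_right
    by (subst sum.swap) (simp add: mult_ac)
  finally show ?thesis .
qed

end

section \<open>Softmax policy gradients\<close>

definition dsoftmax :: "('s \<times> 'a::finite \<Rightarrow> real) \<Rightarrow> ('s \<times> 'a \<Rightarrow> real) \<Rightarrow> 's \<Rightarrow> 'a \<Rightarrow> real" where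
  "dsoftmax th u s a = softmax th s a * (u (s, a) - (\<Sum>b\<in>UNIV. softmax th s b * u (s, b)))"

definition d2softmax :: "('s \<times> 'a::finite \<Rightarrow> real) \<Rightarrow> ('s \<times> 'a \<Rightarrow> real) \<Rightarrow> ('s \<times> 'a \<Rightarrow> real) \<Rightarrow> 's \<Rightarrow> 'a \<Rightarrow> real" where
  "d2softmax th u y s a = dsoftmax th y s a * (u (s, a) - (\<Sum>b\<in>UNIV. softmax th s b * u (s, b)))
     - softmax th s a * (\<Sum>b\<in>UNIV. dsoftmax th y s b * u (s, b))"

text \<open>Calculus takes place along straight lines in parameter space, so that one-variable
  derivatives and the mean value theorem suffice.\<close>

abbreviation (input) line :: "('i \<Rightarrow> real) \<Rightarrow> ('i \<Rightarrow> real) \<Rightarrow> real \<Rightarrow> 'i \<Rightarrow> real" where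
  "line th y x \<equiv> (\<lambda>p. th p + x * y p)"

lemma sum_exp_pos: "0 < (\<Sum>a\<in>(UNIV::'a::finite set). exp (f a :: real))"
  by (rule sum_pos) auto

lemma softmax_pos: "0 < softmax th s a"
  unfolding softmax_def by (simp add: sum_exp_pos)

lemma softmax_sum: "(\<Sum>a\<in>UNIV. softmax th s a) = 1"
  unfolding softmax_def using sum_exp_pos[of "\<lambda>a. th (s, a)"] by (simp add: sum_divide_distrib[symmetric])

lemma is_policy_softmax: "is_policy (softmax th)"
  by (auto simp: is_policy_def softmax_pos less_imp_le softmax_sum)

lemma dsoftmax_sum: "(\<Sum>a\<in>UNIV. dsoftmax th u s a) = 0"
  by (simp add: dsoftmax_def right_diff_distrib sum_subtractf sum_distrib_right[symmetric] softmax_sum)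

lemma softmax_has_derivative:
  "((\<lambda>x. softmax (line th y x) s a) has_real_derivative dsoftmax (line th y x) y s a) (at x)"
proof -
  let ?E = "\<lambda>a. exp (th (s, a) + x * y (s, a))"
  let ?Z = "\<Sum>b\<in>UNIV. ?E b"
  have nz: "?Z \<noteq> 0" using sum_exp_pos[of "\<lambda>a. th (s, a) + x * y (s, a)"] by simp
  have "((\<lambda>x. softmax (line th y x) s a) has_real_derivative
      (?E a * y (s, a) * ?Z - ?E a * (\<Sum>b\<in>UNIV. ?E b * y (s, b))) / (?Z * ?Z)) (at x)"
    unfolding softmax_def
    using nz by (intro DERIV_divide) (auto intro!: derivative_eq_intros)
  also have "(?E a * y (s, a) * ?Z - ?E a * (\<Sum>b\<in>UNIV. ?E b * y (s, b))) / (?Z * ?Z)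
     = dsoftmax (line th y x) y s a"
    using nz by (simp add: dsoftmax_def softmax_def sum_divide_distrib[symmetric] field_simps)
  finally show ?thesis .
qed

lemma dsoftmax_has_derivative:
  "((\<lambda>x. dsoftmax (line th y x) u s a) has_real_derivative d2softmax (line th y x) u y s a) (at x)"
  unfolding dsoftmax_def[of _ u] d2softmax_def
  by (rule DERIV_cong[OF DERIV_mult[OF softmax_has_derivative
      DERIV_diff[OF DERIV_const DERIV_sum[OF DERIV_cmult_right[OF softmax_has_derivative]]]]]) simp

section \<open>Euclidean norm estimates on the parameter space\<close>

lemma sum_prod_UNIV: "(\<Sum>p\<in>UNIV. f p) = (\<Sum>s\<in>UNIV. \<Sum>a\<in>UNIV. f (s, a))"
  for f :: "'s::finite \<times> 'a::finite \<Rightarrow> real"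
  by (simp add: sum.cartesian_product UNIV_Times_UNIV[symmetric] del: UNIV_Times_UNIV)

lemma l2norm_L2_set: "l2norm f = L2_set f UNIV"
  by (simp add: l2norm_def L2_set_def)

lemma l2norm_nonneg: "0 \<le> l2norm f"
  by (simp add: l2norm_def sum_nonneg)

lemma l2norm_power2: "(l2norm f)\<^sup>2 = (\<Sum>i\<in>UNIV. (f i)\<^sup>2)"
  by (simp add: l2norm_def sum_nonneg)

lemma l2norm_Cauchy_Schwarz: "(\<Sum>p\<in>UNIV. \<bar>f p\<bar> * \<bar>h p\<bar>) \<le> l2norm f * l2norm h"
  unfolding l2norm_L2_set by (rule L2_set_mult_ineq)

lemma abs_le_l2norm: "\<bar>f p\<bar> \<le> l2norm f"
  unfolding l2norm_def using member_le_sum[of p UNIV "\<lambda>i. (f i)\<^sup>2"] by (intro real_le_rsqrt) simp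

lemma softmax_mean_le: "\<bar>\<Sum>b\<in>UNIV. softmax th s b * u (s, b)\<bar> \<le> l2norm u"
proof -
  have "\<bar>\<Sum>b\<in>UNIV. softmax th s b * u (s, b)\<bar> \<le> (\<Sum>b\<in>UNIV. softmax th s b * l2norm u)"
    by (intro order.trans[OF sum_abs] sum_mono)
       (simp add: abs_mult softmax_pos less_imp_le mult_left_mono abs_le_l2norm)
  then show ?thesis by (simp add: sum_distrib_right[symmetric] softmax_sum)
qed

lemma dsoftmax_le: "\<bar>dsoftmax th u s a\<bar> \<le> softmax th s a * (2 * l2norm u)"
  unfolding dsoftmax_def abs_mult
  using softmax_mean_le[of th s u] abs_le_l2norm[of u "(s, a)"]
  by (intro mult_mono) (auto simp: softmax_pos less_imp_le l2norm_nonneg)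

section \<open>Gradient and Hessian of the value in the softmax parameters\<close>

context discounted_mdp
begin

definition adv :: "('s \<Rightarrow> 'a \<Rightarrow> real) \<Rightarrow> ('s \<times> 'a \<Rightarrow> real) \<Rightarrow> 's \<Rightarrow> 'a \<Rightarrow> real" where
  "adv r th s a = Qfun P r g (softmax th) s a - Vfun P r g (softmax th) s"

definition pgrad :: "('s \<Rightarrow> 'a \<Rightarrow> real) \<Rightarrow> ('s \<Rightarrow> real) \<Rightarrow> ('s \<times> 'a \<Rightarrow> real) \<Rightarrow> 's \<times> 'a \<Rightarrow> real" where
  "pgrad r mu th = (\<lambda>(s, a). occd (softmax th) mu s * (softmax th s a * adv r th s a))"

lemma softmax_adv_sum: "(\<Sum>a\<in>UNIV. softmax th s a * adv r th s a) = 0"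
  unfolding adv_def
  by (simp add: right_diff_distrib sum_subtractf sum_distrib_right[symmetric] softmax_sum
      Vfun_Bellman[OF is_policy_softmax, symmetric])

text \<open>Two centrings: \<open>dsoftmax\<close> sums to zero, so \<open>Qfun\<close> may be
  replaced by the advantage; the advantage has mean zero, so the mean of \<open>u\<close> drops
  out.\<close>

lemma dsoftmax_Qfun:
  "(\<Sum>a\<in>UNIV. dsoftmax th u s a * Qfun P r g (softmax th) s a) = (\<Sum>a\<in>UNIV. softmax th s a * adv r th s a * u (s, a))"
proof -
  let ?m = "\<Sum>b\<in>UNIV. softmax th s b * u (s, b)" and ?V = "Vfun P r g (softmax th) s"
  have "(\<Sum>a\<in>UNIV. dsoftmax th u s a * Qfun P r g (softmax th) s a)
     = (\<Sum>a\<in>UNIV. dsoftmax th u s a * adv r th s a) + (\<Sum>a\<in>UNIV. dsoftmax th u s a) * ?V"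
    by (simp add: adv_def sum_distrib_right sum.distrib[symmetric] algebra_simps)
  also have "(\<Sum>a\<in>UNIV. dsoftmax th u s a * adv r th s a)
     = (\<Sum>a\<in>UNIV. softmax th s a * adv r th s a * u (s, a)) - (\<Sum>a\<in>UNIV. softmax th s a * adv r th s a) * ?m"
    unfolding dsoftmax_def sum_distrib_right[of _ _ ?m] sum_subtractf[symmetric]
    by (rule sum.cong) (auto simp: algebra_simps)
  finally show ?thesis by (simp add: dsoftmax_sum softmax_adv_sum)
qed

lemma pgrad_inner:
  "(\<Sum>p\<in>UNIV. pgrad r mu th p * u p)
    = (\<Sum>s\<in>UNIV. occd (softmax th) mu s * (\<Sum>a\<in>UNIV. dsoftmax th u s a * Qfun P r g (softmax th) s a))"
  unfolding sum_prod_UNIV dsoftmax_Qfun pgrad_def by (simp add: sum_distrib_left mult.assoc)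

lemma Vfun_softmax_has_derivative:
  "((\<lambda>x. Vfun P r g (softmax (line th y x)) s) has_real_derivative
     (\<Sum>u\<in>UNIV. occ (softmax (line th y x)) s u *
        (\<Sum>a\<in>UNIV. dsoftmax (line th y x) y u a * Qfun P r g (softmax (line th y x)) u a))) (at x)"
  by (rule Vfun_has_derivative[where pol = "\<lambda>x. softmax (line th y x)"])
     (auto intro: is_policy_softmax softmax_has_derivative)

lemma Vdist_has_derivative:
  "((\<lambda>x. Vdist P r g (softmax (line th y x)) mu) has_real_derivative
     (\<Sum>p\<in>UNIV. pgrad r mu (line th y x) p * y p)) (at x)"
proof -
  have "(\<Sum>s\<in>UNIV. mu s * (\<Sum>u\<in>UNIV. occ (softmax (line th y x)) s u *
        (\<Sum>a\<in>UNIV. dsoftmax (line th y x) y u a * Qfun P r g (softmax (line th y x)) u a)))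
      = (\<Sum>p\<in>UNIV. pgrad r mu (line th y x) p * y p)"
    unfolding pgrad_inner occd_def sum_distrib_left sum_distrib_right
    by (subst sum.swap, intro sum.cong refl, subst sum.swap) (simp add: mult_ac)
  then show ?thesis
    unfolding Vdist_def
    by (intro DERIV_cong[OF DERIV_sum[OF DERIV_cmult[OF Vfun_softmax_has_derivative]]])
qed

text \<open>Changing one coordinate is moving along an indicator direction with shifted origin,
  which reduces partial derivatives to directional ones.\<close>

lemma gradV_pgrad: "gradV P r g mu th = pgrad r mu th"
proof
  fix p :: "'s \<times> 'a"
  let ?e = "\<lambda>q. if q = p then 1 else (0::real)"
  have l: "th(p := x) = line th ?e (x - th p)" for x by auto
  have "((\<lambda>x. Vdist P r g (softmax (line th ?e x)) mu) has_real_derivative pgrad r mu th p) (at (th p - th p))"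
    using Vdist_has_derivative[of r th ?e mu 0] by (simp add: if_distrib cong: if_cong)
  then have "((\<lambda>x. Vdist P r g (softmax (th(p := x))) mu) has_real_derivative pgrad r mu th p * 1) (at (th p))"
    unfolding l by (rule DERIV_chain2) (auto intro!: derivative_eq_intros)
  then show "gradV P r g mu th p = pgrad r mu th p"
    unfolding gradV_def by (auto intro: DERIV_imp_deriv)
qed

text \<open>The derivative of the occupancy \<open>occd (softmax th) mu s\<close> in direction \<open>y\<close>.\<close>

definition docc :: "('s \<Rightarrow> real) \<Rightarrow> ('s \<times> 'a \<Rightarrow> real) \<Rightarrow> ('s \<times> 'a \<Rightarrow> real) \<Rightarrow> 's \<Rightarrow> real" where
  "docc mu th y s = (\<Sum>v\<in>UNIV. occd (softmax th) mu v *
     (\<Sum>a\<in>UNIV. dsoftmax th y v a * (g * (\<Sum>s'\<in>UNIV. P v a s' * occ (softmax th) s' s))))"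

lemma occd_has_derivative:
  "((\<lambda>x. occd (softmax (line th y x)) mu s) has_real_derivative docc mu (line th y x) y s) (at x)"
proof -
  let ?r = "\<lambda>s' a. if s' = s then 1 else (0::real)"
  let ?p = "softmax (line th y x)"
  \<comment> \<open>The indicator reward does not depend on the action, so its immediate part is
    annihilated by \<open>dsoftmax_sum\<close> and only the discounted future remains.\<close>
  have 1: "(\<Sum>a\<in>UNIV. dsoftmax (line th y x) y u a * Qfun P ?r g ?p u a)
      = (\<Sum>a\<in>UNIV. dsoftmax (line th y x) y u a * (g * (\<Sum>s'\<in>UNIV. P u a s' * occ ?p s' s)))" for u
    unfolding Qfun_def occ_Vfun[OF is_policy_softmax, symmetric] distrib_left sum.distrib
      sum_distrib_right[symmetric] dsoftmax_sum by simp
  have 2: "(\<Sum>s0\<in>UNIV. mu s0 * (\<Sum>u\<in>UNIV. occ ?p s0 u * f u)) = (\<Sum>u\<in>UNIV. occd ?p mu u * f u)" for f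
    unfolding occd_def sum_distrib_left sum_distrib_right by (subst sum.swap) (simp add: mult_ac)
  show ?thesis
    unfolding docc_def 1[symmetric] 2[symmetric]
    unfolding occd_def occ_Vfun[OF is_policy_softmax]
    unfolding occ_Vfun[OF is_policy_softmax, symmetric]
    by (subst (1) occ_Vfun[OF is_policy_softmax])
      (intro DERIV_sum DERIV_cmult Vfun_softmax_has_derivative)
qed

text \<open>The Hessian of \<open>Vdist\<close> as a bilinear form in \<open>u\<close> and \<open>y\<close>.\<close>

definition bilin :: "('s \<Rightarrow> 'a \<Rightarrow> real) \<Rightarrow> ('s \<Rightarrow> real) \<Rightarrow> ('s \<times> 'a \<Rightarrow> real) \<Rightarrow> ('s \<times> 'a \<Rightarrow> real) \<Rightarrow> ('s \<times> 'a \<Rightarrow> real) \<Rightarrow> real" where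
  "bilin r mu th u y =
     (\<Sum>s\<in>UNIV. docc mu th y s * (\<Sum>a\<in>UNIV. softmax th s a * adv r th s a * u (s, a)))
   + (\<Sum>s\<in>UNIV. docc mu th u s * (\<Sum>a\<in>UNIV. softmax th s a * adv r th s a * y (s, a)))
   + (\<Sum>s\<in>UNIV. occd (softmax th) mu s * (\<Sum>a\<in>UNIV. d2softmax th u y s a * Qfun P r g (softmax th) s a))"

lemma pgrad_inner_has_derivative:
  "((\<lambda>x. \<Sum>p\<in>UNIV. pgrad r mu (line th y x) p * u p) has_real_derivative bilin r mu (line th y x) u y) (at x)"
proof -
  let ?t = "line th y x"
  let ?p = "softmax ?t"
  let ?X = "\<lambda>s. \<Sum>a\<in>UNIV. softmax ?t s a * adv r ?t s a * y (s, a)"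
  have dQ: "((\<lambda>x. Qfun P r g (softmax (line th y x)) s a) has_real_derivative
      g * (\<Sum>s'\<in>UNIV. P s a s' * (\<Sum>v\<in>UNIV. occ ?p s' v * ?X v))) (at x)" for s a
    unfolding Qfun_def
    by (rule DERIV_cong[OF DERIV_add[OF DERIV_const DERIV_cmult[OF DERIV_sum[OF DERIV_cmult[OF Vfun_softmax_has_derivative]]]]])
       (simp add: dsoftmax_Qfun)
  \<comment> \<open>Exchanging sums moves the transition and occupancy kernels from the derivative
    of \<open>Qfun\<close> in direction \<open>y\<close> onto the change of policy in direction
    \<open>u\<close>. This yields the second mixed term of \<open>bilin\<close>, the mirror image of
    the first.\<close>
  have sw: "(\<Sum>s\<in>UNIV. occd ?p mu s * (\<Sum>a\<in>UNIV. (g * (\<Sum>s'\<in>UNIV. P s a s' * (\<Sum>v\<in>UNIV. occ ?p s' v * ?X v))) * dsoftmax ?t u s a))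
      = (\<Sum>v\<in>UNIV. docc mu ?t u v * ?X v)"
  proof -
    have "(\<Sum>s'\<in>UNIV. P s a s' * (\<Sum>v\<in>UNIV. occ ?p s' v * f v)) = (\<Sum>v\<in>UNIV. (\<Sum>s'\<in>UNIV. P s a s' * occ ?p s' v) * f v)" for s a f
      unfolding sum_distrib_left sum_distrib_right by (subst sum.swap) (simp add: mult_ac)
    moreover have "(\<Sum>a\<in>UNIV. (g * (\<Sum>v\<in>UNIV. h a v * f v)) * d a) = (\<Sum>v\<in>UNIV. (\<Sum>a\<in>UNIV. d a * (g * h a v)) * f v)"
      for h :: "'a \<Rightarrow> 's \<Rightarrow> real" and f d
      unfolding sum_distrib_left sum_distrib_right by (subst sum.swap) (simp add: mult_ac)
    moreover have "(\<Sum>s\<in>UNIV. w s * (\<Sum>v\<in>UNIV. k s v * f v)) = (\<Sum>v\<in>UNIV. (\<Sum>s\<in>UNIV. w s * k s v) * f v)"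
      for k :: "'s \<Rightarrow> 's \<Rightarrow> real" and f w
      unfolding sum_distrib_left sum_distrib_right by (subst sum.swap) (simp add: mult_ac)
    ultimately show ?thesis unfolding docc_def by simp
  qed
  show ?thesis
    unfolding pgrad_inner
    apply (rule DERIV_cong[OF DERIV_sum[OF DERIV_mult[OF occd_has_derivative
        DERIV_sum[OF DERIV_mult[OF dsoftmax_has_derivative dQ]]]]])
    unfolding bilin_def sw[symmetric] dsoftmax_Qfun sum.distrib
    by (simp add: distrib_right distrib_left sum.distrib mult_ac)
qed

end

section \<open>Non-uniform smoothness\<close>

context discounted_mdp
begin

text \<open>Bounding \<open>dsoftmax\<close> by a multiple of \<open>softmax\<close> turns the
  signed kernel into the ordinary transition kernel. Flow balance then replaces the shifted
  occupancy by \<open>occd - mu\<close>, at most \<open>k * mu\<close>, and propagating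
  \<open>mu\<close> gives back \<open>occd\<close>. A bound proportional to the occupancy itself is
  what lets the gradient reappear in \<open>bilin_bound\<close>.\<close>

lemma docc_bound:
  assumes mu: "\<And>s. 0 \<le> mu s" and k: "\<And>s. occd (softmax th) mu s \<le> (1 + k) * mu s"
  shows "\<bar>docc mu th y s\<bar> \<le> 2 * l2norm y * k * occd (softmax th) mu s"
proof -
  let ?p = "softmax th" and ?Y = "2 * l2norm y"
  let ?d = "occd ?p mu"
  note pol = is_policy_softmax[of th]
  have d0: "0 \<le> ?d v" for v
    using occd_ge[OF pol, of mu v] mu by (meson order.trans)
  have F0: "0 \<le> g * (\<Sum>s'\<in>UNIV. P v a s' * occ ?p s' s)" for v a
    by (intro mult_nonneg_nonneg g_nonneg sum_nonneg P_nonneg occ_nonneg[OF pol])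
  have "\<bar>docc mu th y s\<bar> \<le> (\<Sum>v\<in>UNIV. ?d v *
     (\<Sum>a\<in>UNIV. (?p v a * ?Y) * (g * (\<Sum>s'\<in>UNIV. P v a s' * occ ?p s' s))))"
    unfolding docc_def
  proof (intro order.trans[OF sum_abs] sum_mono)
    fix v
    show "\<bar>?d v * (\<Sum>a\<in>UNIV. dsoftmax th y v a * (g * (\<Sum>s'\<in>UNIV. P v a s' * occ ?p s' s)))\<bar>
      \<le> ?d v * (\<Sum>a\<in>UNIV. (?p v a * ?Y) * (g * (\<Sum>s'\<in>UNIV. P v a s' * occ ?p s' s)))"
      unfolding abs_mult[of "?d v"] abs_of_nonneg[OF d0]
    proof (intro mult_left_mono d0 order.trans[OF sum_abs] sum_mono)
      fix a
      show "\<bar>dsoftmax th y v a * (g * (\<Sum>s'\<in>UNIV. P v a s' * occ ?p s' s))\<bar>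
        \<le> ?p v a * ?Y * (g * (\<Sum>s'\<in>UNIV. P v a s' * occ ?p s' s))"
        unfolding abs_mult[of "dsoftmax th y v a"] abs_of_nonneg[OF F0]
        by (intro mult_right_mono F0 dsoftmax_le)
    qed
  qed
  also have "\<dots> = ?Y * (\<Sum>s'\<in>UNIV. (g * (\<Sum>v\<in>UNIV. ?d v * Ppi P ?p v s')) * occ ?p s' s)"
  proof -
    have "(\<Sum>a\<in>UNIV. (?p v a * ?Y) * (g * (\<Sum>s'\<in>UNIV. P v a s' * occ ?p s' s)))
       = ?Y * g * (\<Sum>s'\<in>UNIV. Ppi P ?p v s' * occ ?p s' s)" for v
      unfolding Ppi_def sum_distrib_left sum_distrib_right by (subst sum.swap) (simp add: mult_ac)
    moreover have "(\<Sum>v\<in>UNIV. ?d v * (?Y * g * (\<Sum>s'\<in>UNIV. Ppi P ?p v s' * occ ?p s' s)))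
      = ?Y * (\<Sum>s'\<in>UNIV. (g * (\<Sum>v\<in>UNIV. ?d v * Ppi P ?p v s')) * occ ?p s' s)"
      unfolding sum_distrib_left sum_distrib_right by (subst sum.swap) (simp add: mult_ac)
    ultimately show ?thesis by simp
  qed
  also have "\<dots> = ?Y * (\<Sum>s'\<in>UNIV. (?d s' - mu s') * occ ?p s' s)"
    by (subst (2) occd_right[OF pol]) simp
  also have "\<dots> \<le> ?Y * (\<Sum>s'\<in>UNIV. (k * mu s') * occ ?p s' s)"
  proof (intro mult_left_mono sum_mono mult_right_mono occ_nonneg[OF pol])
    show "?d s' - mu s' \<le> k * mu s'" for s' using k[of s'] by (simp add: algebra_simps)
  qed (simp add: l2norm_nonneg)
  also have "\<dots> = ?Y * k * ?d s"
    unfolding occd_def by (simp add: sum_distrib_left mult_ac)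
  finally show ?thesis .
qed

lemma sum_pgrad_bound:
  assumes mu: "\<And>s. 0 \<le> mu s"
  shows "(\<Sum>s\<in>UNIV. occd (softmax th) mu s * \<bar>\<Sum>a\<in>UNIV. softmax th s a * adv r th s a * u (s, a)\<bar>)
    \<le> l2norm (pgrad r mu th) * l2norm u"
proof -
  have d0: "0 \<le> occd (softmax th) mu v" for v
    using occd_ge[OF is_policy_softmax, of mu v] mu by (meson order.trans)
  have "(\<Sum>s\<in>UNIV. occd (softmax th) mu s * \<bar>\<Sum>a\<in>UNIV. softmax th s a * adv r th s a * u (s, a)\<bar>)
    \<le> (\<Sum>s\<in>UNIV. occd (softmax th) mu s * (\<Sum>a\<in>UNIV. \<bar>softmax th s a * adv r th s a\<bar> * \<bar>u (s, a)\<bar>))"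
    by (intro sum_mono mult_left_mono d0 order.trans[OF sum_abs]) (simp add: abs_mult)
  also have "\<dots> = (\<Sum>p\<in>UNIV. \<bar>pgrad r mu th p\<bar> * \<bar>u p\<bar>)"
    unfolding sum_prod_UNIV pgrad_def by (simp add: sum_distrib_left abs_mult d0 mult.assoc)
  finally show ?thesis using l2norm_Cauchy_Schwarz[of "pgrad r mu th" u] by linarith
qed

text \<open>Every term acquires the factor \<open>softmax * adv\<close>, which up to the occupancy
  is a gradient entry. Of the four products of centred directions, the one with both means vanishes
  because advantages have mean zero; the other three give the constant 3 in
  \<open>d2_bound\<close>.\<close>

lemma d2softmax_Qfun:
  "(\<Sum>a\<in>UNIV. d2softmax th u y s a * Qfun P r g (softmax th) s a)
   = (\<Sum>a\<in>UNIV. softmax th s a * adv r th s a *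
       (u (s, a) * y (s, a) - (\<Sum>b\<in>UNIV. softmax th s b * u (s, b)) * y (s, a)
          - u (s, a) * (\<Sum>b\<in>UNIV. softmax th s b * y (s, b))))"
proof -
  let ?p = "softmax th s" and ?Q = "Qfun P r g (softmax th) s" and ?V = "Vfun P r g (softmax th) s"
  let ?um = "\<Sum>b\<in>UNIV. ?p b * u (s, b)" and ?ym = "\<Sum>b\<in>UNIV. ?p b * y (s, b)"
  have K: "(\<Sum>b\<in>UNIV. dsoftmax th y s b * u (s, b)) = (\<Sum>b\<in>UNIV. dsoftmax th y s b * (u (s, b) - ?um))"
    by (simp add: right_diff_distrib sum_subtractf sum_distrib_right[symmetric] dsoftmax_sum)
  have "(\<Sum>a\<in>UNIV. d2softmax th u y s a * ?Q a)
     = (\<Sum>a\<in>UNIV. dsoftmax th y s a * (u (s, a) - ?um) * ?Q a) - (\<Sum>a\<in>UNIV. ?p a * ?Q a) * (\<Sum>b\<in>UNIV. dsoftmax th y s b * u (s, b))"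
    unfolding d2softmax_def left_diff_distrib sum_subtractf sum_distrib_right[of _ _ "sum _ _"] by (simp add: mult_ac)
  also have "\<dots> = (\<Sum>a\<in>UNIV. dsoftmax th y s a * (u (s, a) - ?um) * adv r th s a)"
    unfolding Vfun_Bellman[OF is_policy_softmax, symmetric] K adv_def
    by (simp add: right_diff_distrib sum_subtractf sum_distrib_left mult_ac)
  also have "\<dots> = (\<Sum>a\<in>UNIV. ?p a * adv r th s a * (u (s, a) * y (s, a) - ?um * y (s, a) - u (s, a) * ?ym))
     + (\<Sum>a\<in>UNIV. ?p a * adv r th s a) * (?um * ?ym)"
    unfolding dsoftmax_def sum_distrib_right[of _ _ "_ * _"] sum.distrib[symmetric]
    by (rule sum.cong) (auto simp: algebra_simps)
  finally show ?thesis by (simp add: softmax_adv_sum)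
qed

lemma d2_bound:
  assumes mu: "\<And>s. 0 \<le> mu s"
  shows "\<bar>\<Sum>s\<in>UNIV. occd (softmax th) mu s * (\<Sum>a\<in>UNIV. d2softmax th u y s a * Qfun P r g (softmax th) s a)\<bar>
    \<le> 3 * l2norm (pgrad r mu th) * l2norm u * l2norm y"
proof -
  let ?um = "\<lambda>s. \<Sum>b\<in>UNIV. softmax th s b * u (s, b)" and ?ym = "\<lambda>s. \<Sum>b\<in>UNIV. softmax th s b * y (s, b)"
  let ?G = "pgrad r mu th"
  let ?w = "\<lambda>p. u p * y p - ?um (fst p) * y p - u p * ?ym (fst p)"
  have eq: "(\<Sum>s\<in>UNIV. occd (softmax th) mu s * (\<Sum>a\<in>UNIV. d2softmax th u y s a * Qfun P r g (softmax th) s a))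
     = (\<Sum>p\<in>UNIV. ?G p * ?w p)"
    unfolding d2softmax_Qfun sum_prod_UNIV pgrad_def by (simp add: sum_distrib_left mult.assoc)
  have "\<bar>\<Sum>p\<in>UNIV. ?G p * ?w p\<bar> \<le> (\<Sum>p\<in>UNIV. (\<bar>?G p\<bar> * \<bar>u p\<bar>) * (2 * l2norm y) + (\<bar>?G p\<bar> * \<bar>y p\<bar>) * l2norm u)"
  proof (intro order.trans[OF sum_abs] sum_mono)
    fix p
    have "\<bar>?w p\<bar> \<le> \<bar>u p\<bar> * \<bar>y p\<bar> + \<bar>?um (fst p)\<bar> * \<bar>y p\<bar> + \<bar>u p\<bar> * \<bar>?ym (fst p)\<bar>"
      unfolding abs_mult[symmetric] by linarith
    also have "\<dots> \<le> \<bar>u p\<bar> * l2norm y + l2norm u * \<bar>y p\<bar> + \<bar>u p\<bar> * l2norm y"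
      by (intro add_mono mult_mono abs_le_l2norm softmax_mean_le) (auto simp: l2norm_nonneg)
    finally have "\<bar>?G p\<bar> * \<bar>?w p\<bar> \<le> \<bar>?G p\<bar> * (\<bar>u p\<bar> * l2norm y + l2norm u * \<bar>y p\<bar> + \<bar>u p\<bar> * l2norm y)"
      by (rule mult_left_mono) simp
    also have "\<dots> = (\<bar>?G p\<bar> * \<bar>u p\<bar>) * (2 * l2norm y) + (\<bar>?G p\<bar> * \<bar>y p\<bar>) * l2norm u"
      by (simp add: algebra_simps)
    finally show "\<bar>?G p * ?w p\<bar> \<le> (\<bar>?G p\<bar> * \<bar>u p\<bar>) * (2 * l2norm y) + (\<bar>?G p\<bar> * \<bar>y p\<bar>) * l2norm u"
      unfolding abs_mult[of "?G p"] .
  qed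
  also have "\<dots> \<le> (l2norm ?G * l2norm u) * (2 * l2norm y) + (l2norm ?G * l2norm y) * l2norm u"
  proof -
    have 1: "(\<Sum>p\<in>UNIV. \<bar>?G p\<bar> * \<bar>v p\<bar>) * z \<le> (l2norm ?G * l2norm v) * z" if "0 \<le> z" for v z
      using l2norm_Cauchy_Schwarz that by (rule mult_right_mono)
    have 2: "(\<Sum>p\<in>UNIV. f p * z + h p * w) = (\<Sum>p\<in>UNIV. f p) * z + (\<Sum>p\<in>UNIV. h p) * w"
      for f h :: "'s \<times> 'a \<Rightarrow> real" and z w by (simp add: sum.distrib sum_distrib_right)
    show ?thesis
      unfolding 2 by (intro add_mono 1) (auto simp: l2norm_nonneg)
  qed
  also have "\<dots> = 3 * l2norm ?G * l2norm u * l2norm y" by simp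
  finally show ?thesis unfolding eq .
qed

lemma bilin_bound:
  assumes mu: "\<And>s. 0 \<le> mu s" and k: "\<And>s. occd (softmax th) mu s \<le> (1 + k) * mu s" "0 \<le> k"
  shows "\<bar>bilin r mu th u y\<bar> \<le> (3 + 4 * k) * l2norm (pgrad r mu th) * l2norm u * l2norm y"
proof -
  have b: "\<bar>\<Sum>s\<in>UNIV. docc mu th y s * (\<Sum>a\<in>UNIV. softmax th s a * adv r th s a * u (s, a))\<bar>
     \<le> 2 * k * l2norm y * (l2norm (pgrad r mu th) * l2norm u)" for u y
  proof -
    have "\<bar>\<Sum>s\<in>UNIV. docc mu th y s * (\<Sum>a\<in>UNIV. softmax th s a * adv r th s a * u (s, a))\<bar>
      \<le> (\<Sum>s\<in>UNIV. (2 * l2norm y * k * occd (softmax th) mu s) * \<bar>\<Sum>a\<in>UNIV. softmax th s a * adv r th s a * u (s, a)\<bar>)"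
      by (intro order.trans[OF sum_abs] sum_mono)
         (simp add: abs_mult mult_right_mono docc_bound[OF mu k(1)])
    also have "\<dots> = 2 * k * l2norm y * (\<Sum>s\<in>UNIV. occd (softmax th) mu s * \<bar>\<Sum>a\<in>UNIV. softmax th s a * adv r th s a * u (s, a)\<bar>)"
      by (simp add: sum_distrib_left mult_ac)
    also have "\<dots> \<le> 2 * k * l2norm y * (l2norm (pgrad r mu th) * l2norm u)"
      using k(2) by (intro mult_left_mono sum_pgrad_bound mu) (auto simp: l2norm_nonneg)
    finally show ?thesis .
  qed
  let ?n = "l2norm (pgrad r mu th) * l2norm u * l2norm y"
  have "\<bar>bilin r mu th u y\<bar> \<le> 2 * k * ?n + 2 * k * ?n + 3 * ?n"
    unfolding bilin_def using b[of y u] b[of u y] d2_bound[of mu th u y r, OF mu]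
    by (intro order.trans[OF abs_triangle_ineq] add_mono) (auto simp: mult_ac)
  then show ?thesis by (simp add: algebra_simps)
qed

text \<open>The doubling bound is self-referential: at the point \<open>m\<close> of the segment
  where the gradient norm \<open>N\<close> is largest, \<open>N m <= N 0 + b * e * N m\<close>, and
  \<open>b * e <= 1/2\<close> absorbs the last term. The lost curvature is then at most half of the
  first-order gain.\<close>

lemma normalized_ascent:
  fixes r :: "'s \<Rightarrow> 'a \<Rightarrow> real" and mu :: "'s \<Rightarrow> real" and th :: "'s \<times> 'a \<Rightarrow> real"
  assumes mu: "\<And>s. 0 \<le> mu s" and k: "\<And>pol s. is_policy pol \<Longrightarrow> occd pol mu s \<le> (1 + k) * mu s" "0 \<le> k"
    and e: "0 \<le> e" "(3 + 4 * k) * e \<le> 1 / 2"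
  defines "G \<equiv> pgrad r mu th"
  shows "Vdist P r g (softmax (\<lambda>p. th p + e * G p / l2norm G)) mu - Vdist P r g (softmax th) mu
     \<ge> e * l2norm G / 2"
proof (cases "l2norm G = 0")
  \<comment> \<open>For a zero gradient, division by zero gives 0: the iterate stays put and both
    sides vanish, as the closing \<open>simp\<close> finds.\<close>
  case False
  define y where "y = (\<lambda>p. G p / l2norm G)"
  define b where "b = 3 + 4 * k"
  define N where "N x = l2norm (pgrad r mu (line th y x))" for x
  have b0: "0 \<le> b" using k(2) by (simp add: b_def)
  have unit: "l2norm (\<lambda>p. f p / l2norm f) = 1" if "l2norm f \<noteq> 0" for f :: "'s \<times> 'a \<Rightarrow> real"
  proof -
    have "(l2norm (\<lambda>p. f p / l2norm f))\<^sup>2 = (\<Sum>p\<in>UNIV. (f p)\<^sup>2) / (l2norm f)\<^sup>2"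
      unfolding l2norm_power2[of "\<lambda>p. _ p / _"] by (simp add: power_divide sum_divide_distrib)
    also have "\<dots> = 1" using that by (simp add: l2norm_power2[symmetric])
    finally show ?thesis using l2norm_nonneg[of "\<lambda>p. f p / l2norm f"]
      by (auto simp: power2_eq_1_iff)
  qed
  have self: "(\<Sum>p\<in>UNIV. f p * (f p / l2norm f)) = l2norm f" for f :: "'s \<times> 'a \<Rightarrow> real"
  proof -
    have "(\<Sum>p\<in>UNIV. f p * (f p / l2norm f)) = (l2norm f)\<^sup>2 / l2norm f"
      unfolding l2norm_power2 by (simp add: sum_divide_distrib power2_eq_square)
    then show ?thesis by (simp add: power2_eq_square)
  qed
  have y1: "l2norm y = 1" using unit[OF False] by (simp add: y_def)
  have bb: "\<bar>bilin r mu (line th y x) u y\<bar> \<le> b * N x" if "l2norm u = 1" for x u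
    using bilin_bound[of mu "line th y x" k r u y, OF mu k(1)[OF is_policy_softmax] k(2)] that y1
    by (simp add: b_def N_def)
  have cont: "continuous_on {0..e} N"
  proof -
    have "continuous_on UNIV (\<lambda>x. pgrad r mu (line th y x) p)" for p
    proof -
      let ?i = "\<lambda>q. if q = p then 1 else (0::real)"
      have eq: "(\<Sum>q\<in>UNIV. pgrad r mu (line th y x) q * ?i q) = pgrad r mu (line th y x) p" for x
        by (simp add: if_distrib cong: if_cong)
      have "isCont (\<lambda>x. \<Sum>q\<in>UNIV. pgrad r mu (line th y x) q * ?i q) x" for x
        using pgrad_inner_has_derivative by (rule DERIV_isCont)
      then have "isCont (\<lambda>x. pgrad r mu (line th y x) p) x" for x unfolding eq .
      then show ?thesis by (simp add: continuous_at_imp_continuous_on)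
    qed
    then show ?thesis unfolding N_def l2norm_def
      by (intro continuous_intros) (auto intro: continuous_on_subset)
  qed
  then obtain m where m: "m \<in> {0..e}" "\<And>x. x \<in> {0..e} \<Longrightarrow> N x \<le> N m"
    using continuous_attains_sup[of "{0..e}" N] e(1) by auto
  have N0: "N 0 = l2norm G" by (simp add: N_def G_def)
  have Nm: "N m \<le> 2 * N 0"
  proof (cases "m = 0 \<or> N m = 0")
    case True
    then show ?thesis using l2norm_nonneg[of G] N0 by auto
  next
    case F: False
    \<comment> \<open>Pairing with the fixed unit vector of the gradient at \<open>m\<close>
      recovers \<open>N m\<close> exactly and leaves a scalar function of the line parameter, to
      which the mean value theorem applies.\<close>
    define u where "u = (\<lambda>p. pgrad r mu (line th y m) p / N m)"
    have u1: "l2norm u = 1" using F unit[of "pgrad r mu (line th y m)"] by (simp add: u_def N_def)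
    have "\<exists>z. 0 < z \<and> z < m \<and>
      (\<Sum>p\<in>UNIV. pgrad r mu (line th y m) p * u p) - (\<Sum>p\<in>UNIV. pgrad r mu (line th y 0) p * u p)
         = (m - 0) * bilin r mu (line th y z) u y"
      using F m(1) by (intro MVT2 pgrad_inner_has_derivative) auto
    then obtain z where z: "0 < z" "z < m"
      "(\<Sum>p\<in>UNIV. pgrad r mu (line th y m) p * u p) - (\<Sum>p\<in>UNIV. pgrad r mu (line th y 0) p * u p)
         = m * bilin r mu (line th y z) u y" by auto
    have 1: "(\<Sum>p\<in>UNIV. pgrad r mu (line th y m) p * u p) = N m"
      unfolding u_def N_def by (rule self)
    have "\<bar>\<Sum>p\<in>UNIV. pgrad r mu (line th y 0) p * u p\<bar> \<le> N 0 * l2norm u"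
      unfolding N_def by (rule order.trans[OF _ l2norm_Cauchy_Schwarz]) (rule order.trans[OF sum_abs], simp add: abs_mult)
    then have 2: "(\<Sum>p\<in>UNIV. pgrad r mu (line th y 0) p * u p) \<le> N 0" using u1 by simp
    have "m * bilin r mu (line th y z) u y \<le> m * (b * N m)"
    proof (rule mult_left_mono)
      have "N z \<le> N m" using z m by auto
      then have "b * N z \<le> b * N m" using b0 by (rule mult_left_mono)
      then show "bilin r mu (line th y z) u y \<le> b * N m" using bb[OF u1, of z] by linarith
    qed (use m in auto)
    also have "\<dots> \<le> e * (b * N m)"
      using m(1) b0 by (intro mult_right_mono) (auto simp: N_def l2norm_nonneg)
    also have "\<dots> = (b * e) * N m" by (simp add: mult_ac)
    also have "\<dots> \<le> 1 / 2 * N m"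
      using e(2) by (intro mult_right_mono) (auto simp: b_def N_def l2norm_nonneg)
    finally show ?thesis using z(3) 1 2 by linarith
  qed
  let ?J = "\<lambda>x. Vdist P r g (softmax (line th y x)) mu"
  let ?h = "\<lambda>x. \<Sum>p\<in>UNIV. pgrad r mu (line th y x) p * y p"
  have h: "?h x \<ge> N 0 - 2 * b * x * N 0" if x: "0 \<le> x" "x \<le> e" for x
  proof (cases "x = 0")
    case True
    then show ?thesis using self[of G] by (simp add: N0 y_def G_def)
  next
    case F: False
    have "\<exists>z. 0 < z \<and> z < x \<and> ?h x - ?h 0 = (x - 0) * bilin r mu (line th y z) y y"
      using F x by (intro MVT2 pgrad_inner_has_derivative) auto
    then obtain z where z: "0 < z" "z < x" "?h x - ?h 0 = x * bilin r mu (line th y z) y y" by auto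
    have h0: "?h 0 = N 0" using self[of G] by (simp add: N0 y_def G_def)
    have "b * N z \<le> b * (2 * N 0)" using z x m(2)[of z] Nm b0 by (intro mult_left_mono) auto
    then have "- (b * (2 * N 0)) \<le> bilin r mu (line th y z) y y" using bb[OF y1, of z] by linarith
    then have "x * (- (b * (2 * N 0))) \<le> x * bilin r mu (line th y z) y y" using x by (intro mult_left_mono)
    then show ?thesis using z(3) h0 by (simp add: algebra_simps)
  qed
  \<comment> \<open>Monotonicity of \<open>?f\<close> integrates the lower bound \<open>h\<close> on
    the slope; the quadratic term is the antiderivative of \<open>2 * b * x * N 0\<close>.\<close>
  let ?f = "\<lambda>x. ?J x - N 0 * x + b * N 0 * x\<^sup>2"
  have "?f 0 \<le> ?f e"
  proof (rule DERIV_nonneg_imp_nondecreasing[OF e(1)])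
    fix x assume x: "0 \<le> x" "x \<le> e"
    have "(?f has_real_derivative (?h x - N 0 + b * N 0 * (2 * x))) (at x)"
      by (auto intro!: derivative_eq_intros Vdist_has_derivative)
    moreover have "0 \<le> ?h x - N 0 + b * N 0 * (2 * x)" using h[OF x] by (simp add: mult_ac)
    ultimately show "\<exists>D. (?f has_real_derivative D) (at x) \<and> 0 \<le> D" by blast
  qed
  then have "?J e - ?J 0 \<ge> N 0 * e - (b * e) * (N 0 * e)" by (simp add: power2_eq_square mult_ac)
  moreover have "(b * e) * (N 0 * e) \<le> 1 / 2 * (N 0 * e)"
    using e by (intro mult_right_mono) (auto simp: b_def N0 l2norm_nonneg)
  ultimately have "?J e - ?J 0 \<ge> N 0 * e / 2" by linarith
  then show ?thesis by (simp add: y_def N0 mult_ac)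
qed simp

end

section \<open>Convergence of the policies\<close>

lemma tendsto_zero_factor:
  fixes p A :: "nat \<Rightarrow> real"
  assumes "(\<lambda>t. p t * A t) \<longlonglongrightarrow> 0" "A \<longlonglongrightarrow> L" "L \<noteq> 0"
  shows "p \<longlonglongrightarrow> 0"
proof -
  have "(\<lambda>t. p t * A t / A t) \<longlonglongrightarrow> 0 / L" using assms by (intro tendsto_divide)
  moreover have "eventually (\<lambda>t. A t \<noteq> 0) sequentially"
    using assms(2,3) by (rule tendsto_imp_eventually_ne)
  then have "eventually (\<lambda>t. p t * A t / A t = p t) sequentially" by eventually_elim simp
  ultimately show ?thesis using Lim_transform_eventually by fastforce
qed

text \<open>Dynamics of one state, with step sizes \<open>k\<close> that may be unbounded. If \<open>L a > 0\<close> then \<open>x t a\<close>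
  eventually increases while \<open>p t a\<close> tends to 0. Were \<open>x t a\<close> bounded, then \<open>k t * p t a\<close> would be
  summable, which bounds every coordinate from below, hence (the coordinate sum is constant) from
  above, contradicting \<open>p t a\<close> tending to 0. So \<open>x t a\<close> diverges, and so do the coordinates in the set
  \<open>B\<close> of actions that stay above \<open>a\<close>; but the sum over \<open>B\<close> is eventually nonincreasing, because the
  contribution of \<open>a\<close> outweighs that of all other actions outside \<open>B\<close>.\<close>

lemma softmax_ascent_limit_nonpos:
  fixes x A :: "nat \<Rightarrow> 'a::finite \<Rightarrow> real" and k :: "nat \<Rightarrow> real"
  defines "p \<equiv> \<lambda>t a. exp (x t a) / (\<Sum>b\<in>UNIV. exp (x t b))"
  assumes upd: "\<And>t a. x (Suc t) a = x t a + k t * (p t a * A t a)"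
    and k0: "\<And>t. 0 \<le> k t"
    and zero: "\<And>t. (\<Sum>a\<in>UNIV. p t a * A t a) = 0"
    and step: "\<And>t a. \<bar>k t * (p t a * A t a)\<bar> \<le> e"
    and lim: "\<And>a. (\<lambda>t. A t a) \<longlonglongrightarrow> L a"
    and grad0: "\<And>a. (\<lambda>t. p t a * A t a) \<longlonglongrightarrow> 0"
  shows "L a \<le> 0"
proof (rule ccontr)
  assume "\<not> L a \<le> 0"
  define d where "d = L a / 2"
  have d: "0 < d" "d < L a" using \<open>\<not> L a \<le> 0\<close> by (auto simp: d_def)
  have Zpos: "0 < (\<Sum>b\<in>UNIV. exp (x t b))" for t by (rule sum_pos) auto
  have p0: "0 < p t b" for t b by (simp add: p_def Zpos)
  have psum: "(\<Sum>b\<in>UNIV. p t b) = 1" for t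
    using Zpos[of t] by (simp add: p_def sum_divide_distrib[symmetric])
  have pmono: "p t b \<le> p t c" if "x t b \<le> x t c" for t b c
    using that Zpos[of t] by (simp add: p_def divide_right_mono)
  have pto0: "(\<lambda>t. p t b) \<longlonglongrightarrow> 0" if "L b \<noteq> 0" for b
    using tendsto_zero_factor[OF grad0 lim that] .
  have pa0: "(\<lambda>t. p t a) \<longlonglongrightarrow> 0" using pto0 d by auto
  have "\<exists>M. \<forall>t. \<bar>A t b\<bar> \<le> M" for b
    using convergent_imp_Bseq[of "\<lambda>t. A t b"] lim[of b] by (auto simp: convergent_def Bseq_def)
  then obtain M0 where M0: "\<And>t b. \<bar>A t b\<bar> \<le> M0 b" by metis
  define M where "M = 1 + Max (range M0)"
  have M0M: "M0 b \<le> M - 1" for b by (simp add: M_def)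
  have M: "\<bar>A t b\<bar> \<le> M" for t b using M0[of t b] M0M[of b] by linarith
  have M1: "1 \<le> M" using M0[of 0 a] M0M[of a] by linarith
  have "eventually (\<lambda>t. (L b > 0 \<longrightarrow> A t b > 0) \<and> (L b < 0 \<longrightarrow> A t b < 0) \<and> (L b \<le> 0 \<longrightarrow> A t b < d)) sequentially" for b
    using order_tendstoD[OF lim[of b]] d(1)
    by (cases "L b" "0::real" rule: linorder_cases)
       (auto intro: eventually_conj order.strict_trans elim: eventually_mono)
  then have "eventually (\<lambda>t. \<forall>b. (L b > 0 \<longrightarrow> A t b > 0) \<and> (L b < 0 \<longrightarrow> A t b < 0) \<and> (L b \<le> 0 \<longrightarrow> A t b < d)) sequentially"
    by (intro eventually_all_finite)
  moreover have "eventually (\<lambda>t. d < A t a) sequentially" using order_tendstoD(1)[OF lim d(2)] .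
  ultimately obtain T where T: "\<And>t. t \<ge> T \<Longrightarrow> d < A t a"
     "\<And>t b. t \<ge> T \<Longrightarrow> L b > 0 \<Longrightarrow> A t b > 0" "\<And>t b. t \<ge> T \<Longrightarrow> L b < 0 \<Longrightarrow> A t b < 0"
     "\<And>t b. t \<ge> T \<Longrightarrow> L b \<le> 0 \<Longrightarrow> A t b < d"
    using eventually_conj[of "\<lambda>t. d < A t a"] unfolding eventually_sequentially by (metis (no_types, lifting) max.boundedE nat_le_linear)
  have inc: "x t a \<le> x t' a" if "T \<le> t" "t \<le> t'" for t t'
    using that(2)
  proof (induction rule: dec_induct)
    case (step n)
    have "0 \<le> k n * (p n a * A n a)"
      using k0 p0[of n a] T(1)[of n] step d that by (intro mult_nonneg_nonneg) (auto simp: less_imp_le)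
    then show ?case using step upd[of n a] by linarith
  qed simp
  have sumconst: "(\<Sum>b\<in>UNIV. x t b) = (\<Sum>b\<in>UNIV. x 0 b)" for t
    by (induction t) (simp_all add: upd sum.distrib sum_distrib_left[symmetric] zero)
  have unbdd: "\<exists>t0. \<forall>t\<ge>t0. U < x t a" for U
  proof (rule ccontr)
    assume "\<not> (\<exists>t0. \<forall>t\<ge>t0. U < x t a)"
    then have U: "x t a \<le> U" if "t \<ge> T" for t
      by (metis inc that order.trans leI)
    define S where "S n = (\<Sum>i\<in>{T..<n}. k i * p i a)" for n
    have S: "d * S n \<le> x n a - x T a" if "T \<le> n" for n
      using that
    proof (induction rule: dec_induct)
      case (step n)
      have "d * (k n * p n a) \<le> k n * (p n a * A n a)"
        using T(1)[of n] step(1) k0[of n] p0[of n a] mult_left_mono[of d "A n a" "k n * p n a"]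
        by (simp add: mult_ac)
      then show ?case using step upd[of n a] by (simp add: S_def algebra_simps)
    qed (simp add: S_def)
    define R where "R = (U - x T a) / d"
    have SR: "S n \<le> R" if "T \<le> n" for n
      using S[OF that] U[OF that] d by (simp add: R_def field_simps)
    have "e \<ge> 0" using step[of 0 a] by linarith
    \<comment> \<open>Below the level \<open>x T a\<close> an action has at most the probability of
      \<open>a\<close>, so its moves are paid for by the sum \<open>S\<close>, at most
      \<open>R\<close>, scaled by \<open>M\<close>. Above that level, a single move can cross it by
      at most \<open>e\<close>.\<close>
    define lb where "lb b = min (x T b) (x T a) - e - M * R" for b
    have lb: "lb b \<le> x n b" if "T \<le> n" for n b
    proof -
      have "min (x T b) (x T a) - e - M * S n \<le> x n b"
        using that
      proof (induction rule: dec_induct)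
        case base
        then show ?case using \<open>e \<ge> 0\<close> by (simp add: S_def)
      next
        case (step n)
        have S0: "0 \<le> S (Suc n)" unfolding S_def by (intro sum_nonneg mult_nonneg_nonneg k0) (simp add: p0 less_imp_le)
        show ?case
        proof (cases "x n b \<le> x T a")
          case True
          then have "p n b \<le> p n a" using inc[of T n] step(1) by (intro pmono) simp
          have "\<bar>k n * (p n b * A n b)\<bar> \<le> k n * (p n a * M)"
            unfolding abs_mult using k0[of n] p0[of n b] M[of n b] \<open>p n b \<le> p n a\<close>
            by (intro mult_mono) auto
          moreover have "M * S (Suc n) = M * S n + k n * (p n a * M)"
            using step by (simp add: S_def algebra_simps)
          ultimately show ?thesis using step upd[of n b] by linarith
        next
          case False
          have "0 \<le> M * S (Suc n)" using S0 M1 by simp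
          then show ?thesis using False \<open>e \<ge> 0\<close> assms(5)[of n b] upd[of n b] by linarith
        qed
      qed
      moreover have "M * S n \<le> M * R" using SR[OF that] M1 by (intro mult_left_mono) auto
      ultimately show ?thesis by (simp add: lb_def)
    qed
    define ub where "ub b = (\<Sum>c\<in>UNIV. x 0 c) - (\<Sum>c\<in>UNIV - {b}. lb c)" for b
    have ub: "x n b \<le> ub b" if "T \<le> n" for n b
    proof -
      have "x n b = (\<Sum>c\<in>UNIV. x 0 c) - (\<Sum>c\<in>UNIV - {b}. x n c)"
        using sumconst[of n] sum.remove[of UNIV b "x n"] by simp
      then show ?thesis unfolding ub_def using sum_mono[of "UNIV - {b}" lb "x n"] lb[OF that] by simp
    qed
    have "exp (lb a) / (\<Sum>b\<in>UNIV. exp (ub b)) \<le> p n a" if "T \<le> n" for n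
      unfolding p_def using lb[OF that] ub[OF that] Zpos[of n] by (intro frac_le sum_mono) auto
    then have "exp (lb a) / (\<Sum>b\<in>UNIV. exp (ub b)) \<le> 0"
      using pa0 by (intro LIMSEQ_le_const[OF pa0]) auto
    moreover have "0 < exp (lb a) / (\<Sum>b\<in>UNIV. exp (ub b))"
      by (intro divide_pos_pos sum_pos) auto
    ultimately show False by simp
  qed
  define B where "B = {b. \<forall>t\<ge>T. x t a < x t b}"
  have aB: "a \<notin> B" by (auto simp: B_def)
  \<comment> \<open>An action once below \<open>a\<close> stays there: its probability is no larger
    and its advantage is below \<open>d\<close>, hence below that of \<open>a\<close>, so it never
    gains more than \<open>a\<close> does.\<close>
  have persist: "\<exists>t'. \<forall>t\<ge>t'. p t b \<le> p t a" if b: "b \<notin> B" "L b \<le> 0" for b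
  proof -
    obtain t' where t': "t' \<ge> T" "x t' b \<le> x t' a" using b(1) by (force simp: B_def)
    have "x t b \<le> x t a" if "t' \<le> t" for t
      using that
    proof (induction rule: dec_induct)
      case (step n)
      have nT: "T \<le> n" using step t' by simp
      have pn: "p n b \<le> p n a" using step by (intro pmono) simp
      have "p n b * A n b \<le> p n b * A n a"
        using T(1,4)[OF nT] b(2) p0[of n b] by (intro mult_left_mono) (auto simp: less_imp_le intro: less_imp_le less_trans)
      also have "\<dots> \<le> p n a * A n a"
        using T(1)[OF nT] d pn by (intro mult_right_mono) auto
      finally show ?case using step upd[of n a] upd[of n b] mult_left_mono[OF _ k0[of n]] by (metis add_mono)
    qed (use t' in auto)
    then show ?thesis using pmono by blast
  qed
  \<comment> \<open>Otherwise all probabilities vanish: by \<open>pto0\<close> where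
    \<open>L b\<close> is nonzero, and by comparison with \<open>a\<close> where
    \<open>L b = 0\<close>. But they sum to 1.\<close>
  have "B \<noteq> {}"
  proof
    assume "B = {}"
    have "(\<lambda>t. p t b) \<longlonglongrightarrow> 0" for b
    proof (cases "L b = 0")
      case True
      then obtain t' where "\<forall>t\<ge>t'. p t b \<le> p t a" using persist[of b] \<open>B = {}\<close> by auto
      then have "eventually (\<lambda>t. p t b \<le> p t a) sequentially" by (auto simp: eventually_sequentially)
      then show ?thesis using p0
        by (intro tendsto_sandwich[OF _ _ tendsto_const pa0]) (auto intro!: always_eventually simp: less_imp_le)
    qed (rule pto0)
    then have "(\<lambda>t. \<Sum>b\<in>UNIV. p t b) \<longlonglongrightarrow> (\<Sum>b\<in>(UNIV::'a set). 0)" by (intro tendsto_sum)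
    then show False by (simp add: psum LIMSEQ_const_iff)
  qed
  define N where "N = real (CARD('a))"
  have N: "1 \<le> N" by (simp add: N_def)
  \<comment> \<open>Fewer than \<open>N\<close> competitors lie outside \<open>B\<close>; if each
    loses at most \<open>eps * p t a\<close>, their total loss stays within the guaranteed
    contribution \<open>d * p t a\<close> of action \<open>a\<close>.\<close>
  define eps where "eps = d / N"
  have eps: "0 < eps" using d N by (simp add: eps_def)
  have ev: "eventually (\<lambda>t. b \<notin> B \<longrightarrow> b \<noteq> a \<longrightarrow> - (eps * p t a) \<le> p t b * A t b) sequentially" for b
  proof (cases "b \<in> B")
    case bB: False
    consider "L b > 0" | "L b = 0" | "L b < 0" by linarith
    then show ?thesis
    proof cases
      case 1
      have "- (eps * p t a) \<le> p t b * A t b" if "T \<le> t" for t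
      proof -
        have "0 \<le> p t b * A t b" using T(2)[OF that 1] p0[of t b] by simp
        moreover have "0 \<le> eps * p t a" using eps p0[of t a] by simp
        ultimately show ?thesis by linarith
      qed
      then show ?thesis by (auto simp: eventually_sequentially)
    next
      case 2
      obtain t' where t': "\<forall>t\<ge>t'. p t b \<le> p t a" using persist[of b] bB 2 by auto
      then have "eventually (\<lambda>t. p t b \<le> p t a) sequentially" by (auto simp: eventually_sequentially)
      moreover have "eventually (\<lambda>t. - eps < A t b) sequentially"
        using order_tendstoD(1)[OF lim[of b]] 2 eps by simp
      ultimately show ?thesis
      proof eventually_elim
        case (elim t)
        have "p t b * (- eps) \<le> p t b * A t b" using elim p0[of t b] by (intro mult_left_mono) auto
        moreover have "p t b * eps \<le> p t a * eps" using elim eps by (intro mult_right_mono) auto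
        ultimately show ?case by (simp add: mult_ac)
      qed
    next
      case 3
      have dec: "x t b \<le> x T b" if "T \<le> t" for t
        using that
      proof (induction rule: dec_induct)
        case (step n)
        have "k n * (p n b * A n b) \<le> 0"
          using T(3)[OF step(1) 3] k0[of n] p0[of n b] by (simp add: mult_nonneg_nonpos)
        then show ?case using step upd[of n b] by linarith
      qed simp
      \<comment> \<open>The coordinate of \<open>b\<close> no longer rises while that of
        \<open>a\<close> is unbounded; this threshold makes the ratio of their probabilities at most
        \<open>eps / M\<close>.\<close>
      obtain t0 where t0: "\<forall>t\<ge>t0. x T b - ln (eps / M) < x t a" using unbdd by blast
      have "- (eps * p t a) \<le> p t b * A t b" if "T \<le> t" "t0 \<le> t" for t
      proof -
        have "x t b \<le> x t a + ln (eps / M)" using dec[OF that(1)] t0 that(2) by fastforce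
        then have "exp (x t b) \<le> exp (x t a + ln (eps / M))" by simp
        also have "\<dots> = exp (x t a) * (eps / M)" using eps M1 by (simp add: exp_add)
        finally have "p t b \<le> exp (x t a) * (eps / M) / (\<Sum>b\<in>UNIV. exp (x t b))"
          unfolding p_def using Zpos[of t] by (intro divide_right_mono) auto
        then have "p t b \<le> p t a * (eps / M)" by (simp add: p_def mult_ac)
        then have "p t b * M \<le> p t a * eps" using M1 by (simp add: field_simps)
        moreover have "p t b * (- M) \<le> p t b * A t b"
          using M[of t b] p0[of t b] by (intro mult_left_mono) auto
        ultimately show ?thesis by (simp add: mult_ac)
      qed
      then show ?thesis unfolding eventually_sequentially by (meson max.boundedE)
    qed
  qed simp
  have "eventually (\<lambda>t. \<forall>b. b \<notin> B \<longrightarrow> b \<noteq> a \<longrightarrow> - (eps * p t a) \<le> p t b * A t b) sequentially"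
    using ev by (intro eventually_all_finite)
  then obtain T2 where T2: "\<And>t b. t \<ge> T2 \<Longrightarrow> b \<notin> B \<Longrightarrow> b \<noteq> a \<Longrightarrow> - (eps * p t a) \<le> p t b * A t b"
    unfolding eventually_sequentially by blast
  define T3 where "T3 = max T T2"
  have neg: "(\<Sum>b\<in>B. p t b * A t b) \<le> 0" if t: "T3 \<le> t" for t
  proof -
    have tT: "T \<le> t" "T2 \<le> t" using t by (auto simp: T3_def)
    have "(\<Sum>b\<in>- B - {a}. - (eps * p t a)) \<le> (\<Sum>b\<in>- B - {a}. p t b * A t b)"
      using T2[OF tT(2)] by (intro sum_mono) auto
    moreover have "- (N * (eps * p t a)) \<le> (\<Sum>b\<in>- B - {a}. - (eps * p t a))"
    proof -
      have "real (card (- B - {a})) * (eps * p t a) \<le> N * (eps * p t a)"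
        using eps p0[of t a] by (intro mult_right_mono) (auto simp: N_def card_mono)
      then show ?thesis by simp
    qed
    moreover have "N * (eps * p t a) = d * p t a" using N by (simp add: eps_def)
    moreover have "d * p t a \<le> p t a * A t a"
      using T(1)[OF tT(1)] p0[of t a] by (simp add: mult_ac mult_left_mono)
    moreover have "(\<Sum>b\<in>- B. p t b * A t b) = p t a * A t a + (\<Sum>b\<in>- B - {a}. p t b * A t b)"
      using aB by (intro sum.remove) auto
    moreover have "(\<Sum>b\<in>UNIV. p t b * A t b) = (\<Sum>b\<in>B. p t b * A t b) + (\<Sum>b\<in>- B. p t b * A t b)"
      using sum.union_disjoint[of B "- B" "\<lambda>b. p t b * A t b"] by (simp add: Compl_partition)
    ultimately show ?thesis using zero[of t] by linarith
  qed
  have dec: "(\<Sum>b\<in>B. x t b) \<le> (\<Sum>b\<in>B. x T3 b)" if "T3 \<le> t" for t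
    using that
  proof (induction rule: dec_induct)
    case (step n)
    have "k n * (\<Sum>b\<in>B. p n b * A n b) \<le> 0" using neg[OF step(1)] k0[of n] by (simp add: mult_nonneg_nonpos)
    then show ?case using step by (simp add: upd sum.distrib sum_distrib_left)
  qed simp
  \<comment> \<open>The absolute value makes \<open>x t a\<close> positive as well as larger than
    the sum at \<open>T3\<close>, so multiplying by the cardinality of \<open>B\<close> can only
    help.\<close>
  obtain t0 where t0: "\<forall>t\<ge>t0. \<bar>\<Sum>b\<in>B. x T3 b\<bar> < x t a" using unbdd by blast
  define t where "t = max t0 T3"
  have t: "t \<ge> T3" "t \<ge> T" "\<bar>\<Sum>b\<in>B. x T3 b\<bar> < x t a" using t0 by (auto simp: t_def T3_def)
  have "1 \<le> real (card B)" using \<open>B \<noteq> {}\<close> by (simp add: Suc_le_eq card_gt_0_iff)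
  then have "1 * x t a \<le> real (card B) * x t a" using t(3) by (intro mult_right_mono) auto
  also have "\<dots> \<le> (\<Sum>b\<in>B. x t b)"
    using t(2) by (intro sum_bounded_below) (auto simp: B_def less_imp_le)
  finally show False using dec[OF t(1)] t(3) by linarith
qed

lemma mult_exp_ge: "x \<le> x * exp (k * x)" if "0 \<le> k" for x k :: real
proof (cases "0 \<le> x")
  case True
  then show ?thesis using that mult_left_mono[of 1 "exp (k * x)" x] by simp
next
  case False
  then have "exp (k * x) \<le> 1" using that by (simp add: mult_nonneg_nonpos)
  then show ?thesis using False mult_left_mono_neg[of "exp (k * x)" 1 x] by simp
qed

text \<open>A positive infimum over all times needs more than positivity of each term: the tail
  exceeds 1/2, and the finitely many earlier terms have a positive minimum.\<close>

lemma tendsto_1_bounded_below: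
  fixes f :: "nat \<Rightarrow> real"
  assumes "f \<longlonglongrightarrow> 1" "\<And>t. 0 < f t"
  shows "\<exists>d>0. \<forall>t. d \<le> f t"
proof -
  obtain N where N: "\<And>t. t \<ge> N \<Longrightarrow> 1 / 2 < f t"
    using order_tendstoD(1)[OF assms(1), of "1/2"] by (auto simp: eventually_sequentially)
  let ?d = "min (1 / 2) (Min (f ` {..N}))"
  have "?d \<le> f t" for t
  proof (cases "t \<le> N")
    case True
    then have "Min (f ` {..N}) \<le> f t" by (intro Min_le) auto
    then show ?thesis by linarith
  qed (use N[of t] in auto)
  moreover have "0 < ?d" using assms(2) by simp
  ultimately show ?thesis by blast
qed

lemma dvisit_ratio_le_ratio_inf: "d s / mu s \<le> ratio_inf d mu"
proof -
  have "\<bar>d s / mu s\<bar> \<le> ratio_inf d mu" unfolding ratio_inf_def by (intro Max_ge) auto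
  then show ?thesis by linarith
qed

section \<open>Improvement, convergence to the optimum and gradient domination\<close>

context discounted_mdp
begin

lemma Vdist_difference:
  assumes "is_policy pol" "is_policy pol2"
  shows "Vdist P r g pol nu - Vdist P r g pol2 nu
    = (\<Sum>u\<in>UNIV. occd pol nu u * (\<Sum>a\<in>UNIV. pol u a * (Qfun P r g pol2 u a - Vfun P r g pol2 u)))"
  unfolding Vdist_def sum_subtractf[symmetric] right_diff_distrib[of "nu _", symmetric]
    performance_difference[OF assms] occd_def sum_distrib_left[of "nu _"] sum_distrib_right
  by (subst sum.swap) (simp add: mult_ac)

lemma occd_le:
  assumes "is_policy pol" "is_distr nu"
  shows "occd pol nu s \<le> 1 / (1 - g)"
proof -
  have "occd pol nu s \<le> (\<Sum>s0\<in>UNIV. nu s0 * (1 / (1 - g)))"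
    unfolding occd_def using assms by (intro sum_mono mult_left_mono occ_le) (auto simp: is_distr_def)
  then show ?thesis using assms(2) unfolding sum_distrib_right[symmetric] by (simp add: is_distr_def)
qed

text \<open>The supremum is an upper bound only once the ratios are known to be bounded over all
  policies. They are, by the largest \<open>1 / mu s\<close>, since \<open>dvisit\<close> never
  exceeds 1.\<close>

lemma occd_le_SUP_ratio:
  assumes pol: "is_policy pol" and nu: "is_distr nu" and mu: "\<And>s. 0 < mu s"
  shows "occd pol nu s \<le> (SUP pol\<in>{pol. is_policy pol}. ratio_inf (dvisit P g pol nu) mu) / (1 - g) * mu s"
proof -
  have bdd: "bdd_above ((\<lambda>pol. ratio_inf (dvisit P g pol nu) mu) ` {pol. is_policy pol})"
  proof (rule bdd_aboveI2)
    fix pol :: "'s \<Rightarrow> 'a \<Rightarrow> real" assume "pol \<in> {pol. is_policy pol}"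
    then have p: "is_policy pol" by simp
    show "ratio_inf (dvisit P g pol nu) mu \<le> Max (range (\<lambda>s. 1 / mu s))"
      unfolding ratio_inf_def
    proof (rule Max.boundedI)
      fix y assume "y \<in> range (\<lambda>s. \<bar>dvisit P g pol nu s / mu s\<bar>)"
      then obtain s where y: "y = \<bar>dvisit P g pol nu s / mu s\<bar>" by auto
      have "0 \<le> occd pol nu s" using occd_ge[OF p, of nu s] nu by (auto simp: is_distr_def intro: order.trans)
      then have "0 \<le> dvisit P g pol nu s" "dvisit P g pol nu s \<le> 1"
        using occd_le[OF p nu, of s] g_less by (auto simp: dvisit_occd[OF p] pos_le_divide_eq mult.commute)
      then have "y \<le> 1 / mu s" using mu[of s] by (simp add: y divide_right_mono)
      also have "\<dots> \<le> Max (range (\<lambda>s. 1 / mu s))" by (intro Max_ge) auto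
      finally show "y \<le> Max (range (\<lambda>s. 1 / mu s))" .
    qed auto
  qed
  have "dvisit P g pol nu s / mu s \<le> (SUP pol\<in>{pol. is_policy pol}. ratio_inf (dvisit P g pol nu) mu)"
    by (rule order.trans[OF dvisit_ratio_le_ratio_inf cSUP_upper[OF _ bdd]]) (simp add: pol)
  then show ?thesis using mu[of s] g_less by (simp add: dvisit_occd[OF pol] field_simps)
qed

text \<open>The improvement holds for every step size: each action has
  \<open>x \<le> x * exp (k * x)\<close> for \<open>x = softmax th s a * adv r th s a\<close>.\<close>

lemma softmax_update_improves:
  assumes upd: "\<And>s a. th' (s, a) = th (s, a) + k s * (softmax th s a * adv r th s a)" and k: "\<And>s. 0 \<le> k s"
  shows "Vfun P r g (softmax th) s \<le> Vfun P r g (softmax th') s"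
proof -
  \<comment> \<open>The new policy reweights the old one by \<open>exp (k u * ?x a)\<close>, up to a
    positive ratio of normalisers. The old mean advantage is zero, so the reweighted one is
    nonnegative.\<close>
  have *: "0 \<le> (\<Sum>a\<in>UNIV. softmax th' u a * adv r th u a)" for u
  proof -
    let ?Z = "\<Sum>a\<in>UNIV. exp (th (u, a))" and ?Z' = "\<Sum>a\<in>UNIV. exp (th' (u, a))"
    let ?x = "\<lambda>a. softmax th u a * adv r th u a"
    have Z: "0 < ?Z" "0 < ?Z'" by (rule sum_exp_pos)+
    have "softmax th' u a * adv r th u a = ?Z / ?Z' * (?x a * exp (k u * ?x a))" for a
      using Z unfolding softmax_def[of th' u a] upd[of u a] exp_add by (simp add: softmax_def field_simps)
    then have "(\<Sum>a\<in>UNIV. softmax th' u a * adv r th u a) = ?Z / ?Z' * (\<Sum>a\<in>UNIV. ?x a * exp (k u * ?x a))"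
      by (simp add: sum_distrib_left)
    moreover have "(\<Sum>a\<in>UNIV. ?x a) \<le> (\<Sum>a\<in>UNIV. ?x a * exp (k u * ?x a))"
      by (intro sum_mono mult_exp_ge k)
    ultimately show ?thesis using Z by (simp add: softmax_adv_sum)
  qed
  have "0 \<le> Vfun P r g (softmax th') s - Vfun P r g (softmax th) s"
    unfolding performance_difference[OF is_policy_softmax is_policy_softmax] adv_def[symmetric]
    by (rule sum_nonneg, rule mult_nonneg_nonneg) (auto simp: occ_nonneg[OF is_policy_softmax] *)
  then show ?thesis by simp
qed

abbreviation (input) det :: "('s \<Rightarrow> 'a) \<Rightarrow> 's \<Rightarrow> 'a \<Rightarrow> real" where
  "det f \<equiv> (\<lambda>s a. if a = f s then 1 else 0)"

lemma is_policy_det: "is_policy (det f)"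
  by (simp add: is_policy_def)

lemma sum_det: "(\<Sum>a\<in>UNIV. det f s a * h a) = h (f s)"
  by (simp add: if_distrib[of "\<lambda>x. x * _"] cong: if_cong)

lemma Vfun_det: "Vfun P r g (det f) s = Qfun P r g (det f) s (f s)"
  unfolding Vfun_Bellman[OF is_policy_det] sum_det ..

lemma optimal_action_prob_tendsto_1:
  fixes th :: "nat \<Rightarrow> 's \<times> 'a \<Rightarrow> real" and r :: "'s \<Rightarrow> 'a \<Rightarrow> real"
  assumes mu: "\<And>s. 0 < mu s"
    and opt: "\<And>pol s. is_policy pol \<Longrightarrow> Vfun P r g pol s \<le> Vfun P r g (det astar) s"
    and uniq: "\<And>s a. a \<noteq> astar s \<Longrightarrow> Qfun P r g (det astar) s a < Qfun P r g (det astar) s (astar s)"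
    and upd: "\<And>t. th (Suc t) = (\<lambda>p. th t p + e * pgrad r mu (th t) p / l2norm (pgrad r mu (th t)))"
    and e: "0 < e"
    and asc: "\<And>t. e * l2norm (pgrad r mu (th t)) / 2
      \<le> Vdist P r g (softmax (th (Suc t))) mu - Vdist P r g (softmax (th t)) mu"
  shows "(\<lambda>t. softmax (th t) s (astar s)) \<longlonglongrightarrow> 1"
proof -
  let ?G = "\<lambda>t. pgrad r mu (th t)" and ?p = "\<lambda>t. softmax (th t)"
  let ?Vs = "Vfun P r g (det astar)" and ?Qs = "Qfun P r g (det astar)"
  \<comment> \<open>Occupancy depends only on the state, so each state performs its own softmax
    ascent with this multiplier. If the gradient is zero, the multiplier is 0 as well.\<close>
  define k where "k t s = e * occd (?p t) mu s / l2norm (?G t)" for t s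
  have od: "mu s \<le> occd (?p t) mu s" for t s
    using mu by (intro occd_ge is_policy_softmax) (simp add: less_imp_le)
  have k0: "0 \<le> k t s" for t s
    unfolding k_def using e od[of s t] mu[of s] by (intro divide_nonneg_nonneg mult_nonneg_nonneg l2norm_nonneg) linarith+
  have upd': "th (Suc t) (s, a) = th t (s, a) + k t s * (?p t s a * adv r (th t) s a)" for t s a
    by (simp add: upd k_def pgrad_def)
  have "incseq (\<lambda>t. Vfun P r g (?p t) s)" for s
    by (intro incseq_SucI softmax_update_improves[OF upd' k0])
  then have "\<exists>W. (\<lambda>t. Vfun P r g (?p t) s) \<longlonglongrightarrow> W" for s
    using incseq_convergent[of "\<lambda>t. Vfun P r g (?p t) s" "?Vs s"] opt[OF is_policy_softmax] by metis
  then obtain W where W: "\<And>s. (\<lambda>t. Vfun P r g (?p t) s) \<longlonglongrightarrow> W s" by metis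
  define L where "L s a = r s a + g * (\<Sum>s'\<in>UNIV. P s a s' * W s') - W s" for s a
  have advL: "(\<lambda>t. adv r (th t) s a) \<longlonglongrightarrow> L s a" for s a
    unfolding adv_def Qfun_def L_def by (intro tendsto_intros W)
  \<comment> \<open>The objective converges, so its successive gains vanish, and by
    \<open>asc\<close> they dominate the gradient norm.\<close>
  have G0: "(\<lambda>t. l2norm (?G t)) \<longlonglongrightarrow> 0"
  proof -
    have J: "(\<lambda>t. Vdist P r g (?p t) mu) \<longlonglongrightarrow> (\<Sum>s\<in>UNIV. mu s * W s)"
      unfolding Vdist_def by (intro tendsto_intros W)
    have lim: "(\<lambda>t. 2 / e * (Vdist P r g (?p (Suc t)) mu - Vdist P r g (?p t) mu)) \<longlonglongrightarrow> 2 / e * ((\<Sum>s\<in>UNIV. mu s * W s) - (\<Sum>s\<in>UNIV. mu s * W s))"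
      by (intro tendsto_intros J LIMSEQ_Suc[OF J])
    have le: "l2norm (?G t) \<le> 2 / e * (Vdist P r g (?p (Suc t)) mu - Vdist P r g (?p t) mu)" for t
      using asc[of t] e by (simp add: field_simps)
    show ?thesis
    proof (rule tendsto_sandwich)
      show "\<forall>\<^sub>F t in sequentially. 0 \<le> l2norm (?G t)" by (simp add: l2norm_nonneg)
      show "\<forall>\<^sub>F t in sequentially. l2norm (?G t)
          \<le> 2 / e * (Vdist P r g (?p (Suc t)) mu - Vdist P r g (?p t) mu)"
        by (intro always_eventually allI le)
      show "(\<lambda>t. 2 / e * (Vdist P r g (?p (Suc t)) mu - Vdist P r g (?p t) mu)) \<longlonglongrightarrow> 0"
        using lim by simp
    qed (rule tendsto_const)
  qed
  have pA0: "(\<lambda>t. ?p t s a * adv r (th t) s a) \<longlonglongrightarrow> 0" for s a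
  proof (rule Lim_null_comparison)
    show "\<forall>\<^sub>F t in sequentially. norm (?p t s a * adv r (th t) s a) \<le> l2norm (?G t) / mu s"
    proof (intro always_eventually allI)
      fix t
      have "mu s * \<bar>?p t s a * adv r (th t) s a\<bar> \<le> occd (?p t) mu s * \<bar>?p t s a * adv r (th t) s a\<bar>"
        by (intro mult_right_mono od) simp
      also have "\<dots> = \<bar>?G t (s, a)\<bar>"
        using od[of s t] mu[of s] by (simp add: pgrad_def abs_mult)
      also have "\<dots> \<le> l2norm (?G t)" by (rule abs_le_l2norm)
      finally show "norm (?p t s a * adv r (th t) s a) \<le> l2norm (?G t) / mu s"
        using mu[of s] by (simp add: field_simps)
    qed
    show "(\<lambda>t. l2norm (?G t) / mu s) \<longlonglongrightarrow> 0"
      using tendsto_divide[OF G0 tendsto_const, of "mu s"] mu[of s] by simp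
  qed
  have L0: "L s a \<le> 0" for s a
  proof (rule softmax_ascent_limit_nonpos[where x = "\<lambda>t a. th t (s, a)" and A = "\<lambda>t a. adv r (th t) s a"
        and L = "L s" and k = "\<lambda>t. k t s" and e = e], unfold softmax_def[symmetric])
    fix t a
    \<comment> \<open>Entries of a normalised vector are at most 1 in size, which bounds every move
      by \<open>e\<close> even when the multiplier is large.\<close>
    have "\<bar>th (Suc t) (s, a) - th t (s, a)\<bar> \<le> e"
    proof -
      have "\<bar>?G t (s, a)\<bar> / l2norm (?G t) \<le> 1"
        using abs_le_l2norm[of "?G t" "(s, a)"] l2norm_nonneg[of "?G t"] by (auto simp: divide_le_eq_1)
      then have "e * (\<bar>?G t (s, a)\<bar> / l2norm (?G t)) \<le> e * 1" using e by (intro mult_left_mono) auto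
      then show ?thesis using e by (simp add: upd abs_mult l2norm_nonneg)
    qed
    then show "\<bar>k t s * (?p t s a * adv r (th t) s a)\<bar> \<le> e" by (simp add: upd')
  qed (auto simp: upd' k0 softmax_adv_sum advL pA0)
  have WV: "W s = ?Vs s" for s
  proof (rule antisym)
    show "W s \<le> ?Vs s" using opt[OF is_policy_softmax] by (intro LIMSEQ_le_const2[OF W]) auto
    \<comment> \<open>With the occupancy of the optimal policy held fixed, the limit passes through
      the finite sums and leaves only the nonpositive limits \<open>L u (astar u)\<close>.\<close>
    have "(\<lambda>t. ?Vs s - Vfun P r g (?p t) s) \<longlonglongrightarrow> (\<Sum>u\<in>UNIV. occ (det astar) s u * (\<Sum>a\<in>UNIV. det astar u a * L u a))"
      unfolding performance_difference[OF is_policy_det is_policy_softmax] adv_def[symmetric]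
      by (intro tendsto_intros advL)
    moreover have "(\<lambda>t. ?Vs s - Vfun P r g (?p t) s) \<longlonglongrightarrow> ?Vs s - W s" by (intro tendsto_intros W)
    ultimately have "?Vs s - W s = (\<Sum>u\<in>UNIV. occ (det astar) s u * (\<Sum>a\<in>UNIV. det astar u a * L u a))"
      using LIMSEQ_unique by blast
    also have "\<dots> \<le> 0"
      unfolding sum_det by (intro sum_nonpos mult_nonneg_nonpos L0 occ_nonneg is_policy_det)
    finally show "?Vs s \<le> W s" by simp
  qed
  have "L s a < 0" if "a \<noteq> astar s" for a
    using uniq[OF that] by (simp add: L_def WV Vfun_det[of r astar s] Qfun_def[of P r g "det astar" s a, symmetric])
  then have "(\<lambda>t. ?p t s a) \<longlonglongrightarrow> 0" if "a \<noteq> astar s" for a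
    using tendsto_zero_factor[OF pA0 advL] that by force
  then have "(\<lambda>t. 1 - (\<Sum>a\<in>UNIV - {astar s}. ?p t s a)) \<longlonglongrightarrow> 1 - (\<Sum>a\<in>UNIV - {astar s}. 0)"
    by (intro tendsto_intros) auto
  moreover have "1 - (\<Sum>a\<in>UNIV - {astar s}. ?p t s a) = ?p t s (astar s)" for t
    using softmax_sum[of "th t" s] sum.remove[of UNIV "astar s" "?p t s"] by simp
  ultimately show ?thesis by simp
qed

text \<open>The optimal occupancy is at most \<open>R * mu\<close>, hence at most \<open>R\<close>
  times the current one, and inserting \<open>softmax / c\<close>, at least 1, completes each
  advantage of \<open>astar\<close> to a gradient entry. Cauchy-Schwarz over the states costs the
  square root of their number.\<close>

lemma pgrad_Lojasiewicz:
  assumes mu: "\<And>s. 0 \<le> mu s" and c: "0 < c" "\<And>s. c \<le> softmax th s (astar s)"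
    and R: "0 \<le> R" "\<And>s. occd (det astar) mu s \<le> R * mu s"
  shows "Vdist P r g (det astar) mu - Vdist P r g (softmax th) mu
    \<le> R / c * (sqrt (real CARD('s)) * l2norm (pgrad r mu th))"
proof -
  let ?G = "pgrad r mu th"
  have od: "mu s \<le> occd (softmax th) mu s" for s by (intro occd_ge is_policy_softmax mu)
  have "Vdist P r g (det astar) mu - Vdist P r g (softmax th) mu = (\<Sum>u\<in>UNIV. occd (det astar) mu u * adv r th u (astar u))"
    unfolding Vdist_difference[OF is_policy_det is_policy_softmax] adv_def[symmetric] sum_det ..
  also have "\<dots> \<le> (\<Sum>u\<in>UNIV. R / c * \<bar>?G (u, astar u)\<bar>)"
  proof (rule sum_mono)
    fix u
    have "occd (det astar) mu u * adv r th u (astar u) \<le> occd (det astar) mu u * \<bar>adv r th u (astar u)\<bar>"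
      using occd_ge[OF is_policy_det, of mu u] mu by (intro mult_left_mono) (auto intro: order.trans)
    also have "\<dots> \<le> (R * occd (softmax th) mu u) * \<bar>adv r th u (astar u)\<bar>"
      using R(2)[of u] mult_left_mono[OF od R(1), of u] by (intro mult_right_mono) auto
    also have "\<dots> \<le> (R * occd (softmax th) mu u) * (softmax th u (astar u) / c * \<bar>adv r th u (astar u)\<bar>)"
    proof (intro mult_left_mono mult_nonneg_nonneg R(1))
      have "1 \<le> softmax th u (astar u) / c" using c by (simp add: le_divide_eq_1)
      then show "\<bar>adv r th u (astar u)\<bar> \<le> softmax th u (astar u) / c * \<bar>adv r th u (astar u)\<bar>"
        using mult_right_mono[of 1 "softmax th u (astar u) / c" "\<bar>adv r th u (astar u)\<bar>"] by simp
      show "0 \<le> occd (softmax th) mu u" using od mu order.trans by blast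
    qed
    also have "\<dots> = R / c * \<bar>?G (u, astar u)\<bar>"
      using order.trans[OF mu od] by (simp add: pgrad_def abs_mult softmax_pos less_imp_le)
    finally show "occd (det astar) mu u * adv r th u (astar u) \<le> R / c * \<bar>?G (u, astar u)\<bar>" .
  qed
  also have "\<dots> = R / c * (\<Sum>u\<in>UNIV. \<bar>1\<bar> * \<bar>?G (u, astar u)\<bar>)"
    by (simp add: sum_distrib_left)
  also have "\<dots> \<le> R / c * (sqrt (real CARD('s)) * l2norm ?G)"
  proof (intro mult_left_mono)
    have "(\<Sum>u\<in>UNIV. \<bar>1\<bar> * \<bar>?G (u, astar u)\<bar>) \<le> l2norm (\<lambda>u::'s. 1) * l2norm (\<lambda>u. ?G (u, astar u))"
      by (rule l2norm_Cauchy_Schwarz)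
    also have "\<dots> \<le> sqrt (real CARD('s)) * l2norm ?G"
    proof (rule mult_mono)
      show "l2norm (\<lambda>u. ?G (u, astar u)) \<le> l2norm ?G"
        unfolding l2norm_def sum_prod_UNIV
        by (intro real_sqrt_le_mono sum_mono member_le_sum) auto
    qed (auto simp: l2norm_def sum_nonneg)
    finally show "(\<Sum>u\<in>UNIV. \<bar>1\<bar> * \<bar>?G (u, astar u)\<bar>) \<le> sqrt (real CARD('s)) * l2norm ?G" .
  qed (use R c in auto)
  finally show ?thesis .
qed

end

section \<open>Linear convergence of the value gap\<close>

theorem theorem3:
  fixes P :: "'s::finite \<Rightarrow> 'a::finite \<Rightarrow> 's \<Rightarrow> real"
    and r :: "'s \<Rightarrow> 'a \<Rightarrow> real" and g :: real
    and mu rho :: "'s \<Rightarrow> real"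
    and astar :: "'s \<Rightarrow> 'a"
    and theta :: "nat \<Rightarrow> 's \<times> 'a \<Rightarrow> real"
    and eta Cinf Cinf' c C :: real
  assumes mdp: "is_mdp P r g"
    and mu: "is_distr mu" and mu_pos: "\<forall>s. mu s > 0"
    and rho: "is_distr rho"
    and pistar_opt: "\<forall>pol. is_policy pol \<longrightarrow>
          (\<forall>s. Vfun P r g pol s \<le> Vfun P r g (\<lambda>s a. if a = astar s then 1 else 0) s)"
    and unique: "\<forall>s a. a \<noteq> astar s \<longrightarrow>
          Qfun P r g (\<lambda>s a. if a = astar s then 1 else 0) s a
            < Qfun P r g (\<lambda>s a. if a = astar s then 1 else 0) s (astar s)"
    and Cinf_def: "Cinf = (SUP pol\<in>{pol. is_policy pol}. ratio_inf (dvisit P g pol mu) mu)"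
    and Cinf'_def: "Cinf' = (SUP pol\<in>{pol. is_policy pol}. ratio_inf (dvisit P g pol rho) mu)"
    and eta_def: "eta = (1 - g) / (6 * (1 - g) + 8 * (Cinf - (1 - g))) * (1 / sqrt (real CARD('s)))"
    and update: "\<forall>t\<ge>1. theta (Suc t) = (\<lambda>p. theta t p +
          eta * gradV P r g mu (theta t) p / l2norm (gradV P r g mu (theta t)))"
    and c_def: "c = (INF st\<in>UNIV \<times> {1..}. softmax (theta (snd st)) (fst st) (astar (fst st)))"
    and C_def: "C = (1 - g)^2 * c / (12 * (1 - g) + 16 * (Cinf - (1 - g))) * (1 / real CARD('s))
          * inverse (ratio_inf (dvisit P g (\<lambda>s a. if a = astar s then 1 else 0) mu) mu)"
  shows "c > 0 \<and> (\<forall>t\<ge>1.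
     Vdist P r g (\<lambda>s a. if a = astar s then 1 else 0) rho - Vdist P r g (softmax (theta t)) rho
       \<le> (Vdist P r g (\<lambda>s a. if a = astar s then 1 else 0) mu - Vdist P r g (softmax (theta 1)) mu)
          * Cinf' / (1 - g) * exp (- C * (real t - 1)))"
proof -
  interpret discounted_mdp P g
    using mdp by unfold_locales (auto simp: is_mdp_def)
  let ?star = "\<lambda>s a. if a = astar s then 1 else (0::real)"
  let ?G = "\<lambda>t. pgrad r mu (theta t)"
  define k where "k = Cinf / (1 - g) - 1"
  define S where "S = real CARD('s)"
  define R where "R = ratio_inf (dvisit P g ?star mu) mu"
  define gap where "gap t = Vdist P r g ?star mu - Vdist P r g (softmax (theta t)) mu" for t
  have g: "0 < 1 - g" using g_less by simp
  have S: "1 \<le> S" by (simp add: S_def Suc_le_eq)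
  have mu0: "0 < mu s" "0 \<le> mu s" for s using mu_pos by (auto simp: less_imp_le)
  have occ_k: "occd pol mu s \<le> (1 + k) * mu s" if "is_policy pol" for pol s
    using occd_le_SUP_ratio[OF that mu, of mu s] mu0 by (simp add: k_def Cinf_def)
  have k0: "0 \<le> k"
  proof -
    fix s
    \<comment> \<open>The time-zero visit already gives an occupancy of at least
      \<open>mu s\<close>, forcing \<open>1 + k\<close> to be at least 1.\<close>
    have "1 * mu s \<le> (1 + k) * mu s"
      using occd_ge[of ?star mu s, OF is_policy_det mu0(2)] occ_k[OF is_policy_det[of astar], of s] by linarith
    then show ?thesis using mu0(1)[of s] by (simp only: mult_le_cancel_right) auto
  qed
  have Ck: "Cinf = (1 + k) * (1 - g)" using g by (simp add: k_def)
  define m where "m = 3 + 4 * k"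
  have m: "0 < m" using k0 by (simp add: m_def)
  have eta: "eta = 1 / (2 * m * sqrt S)"
  proof -
    have "6 * (1 - g) + 8 * (Cinf - (1 - g)) = (1 - g) * (2 * m)" unfolding m_def by (simp add: Ck algebra_simps)
    then show ?thesis using g by (simp add: eta_def S_def)
  qed
  have eta0: "0 < eta" using m S by (simp add: eta)
  have eta_le: "(3 + 4 * k) * eta \<le> 1 / 2"
  proof -
    have "(3 + 4 * k) * eta = 1 / (2 * sqrt S)" using m S by (simp add: eta flip: m_def)
    also have "\<dots> \<le> 1 / 2" using S by (simp add: field_simps)
    finally show ?thesis .
  qed
  have upd: "theta (Suc t) = (\<lambda>p. theta t p + eta * ?G t p / l2norm (?G t))" if "1 \<le> t" for t
    using update that unfolding gradV_pgrad by simp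
  have asc: "eta * l2norm (?G t) / 2 \<le> Vdist P r g (softmax (theta (Suc t))) mu - Vdist P r g (softmax (theta t)) mu" if "1 \<le> t" for t
    unfolding upd[OF that] using eta0 eta_le by (intro normalized_ascent[where k = k] mu0 occ_k k0) auto
  \<comment> \<open>The recursion constrains \<open>theta\<close> only from index 1 on, so the limit
    lemma is applied to the shifted sequence.\<close>
  have "(\<lambda>t. softmax (theta (Suc t)) s (astar s)) \<longlonglongrightarrow> 1" for s
    using pistar_opt unique eta0
    by (intro optimal_action_prob_tendsto_1[where mu = mu and e = eta and r = r] mu0 asc) (auto simp: upd)
  then have "\<exists>d>0. \<forall>t. d \<le> softmax (theta (Suc t)) s (astar s)" for s
    by (intro tendsto_1_bounded_below softmax_pos)
  then obtain d where d: "\<And>s. 0 < d s" "\<And>s t. d s \<le> softmax (theta (Suc t)) s (astar s)" by metis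
  have c0: "0 < c"
  proof -
    have "Min (range d) \<le> softmax (theta t) s (astar s)" if "1 \<le> t" for t s
    proof -
      have "Min (range d) \<le> d s" by (intro Min_le) auto
      also have "\<dots> \<le> softmax (theta t) s (astar s)" using d(2)[of s "t - 1"] that by simp
      finally show ?thesis .
    qed
    then have "Min (range d) \<le> c" unfolding c_def by (intro cINF_greatest) auto
    moreover have "0 < Min (range d)" using d(1) by simp
    ultimately show ?thesis by linarith
  qed
  have cle: "c \<le> softmax (theta t) s (astar s)" if "1 \<le> t" for t s
  proof -
    have "bdd_below ((\<lambda>st. softmax (theta (snd st)) (fst st) (astar (fst st))) ` (UNIV \<times> {1..}))"
      by (rule bdd_belowI2[where m = 0]) (simp add: softmax_pos less_imp_le)
    then show ?thesis unfolding c_def using cINF_lower[of _ _ "(s, t)"] that by fastforce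
  qed
  have occ_R: "occd ?star mu s \<le> R / (1 - g) * mu s" for s
    using dvisit_ratio_le_ratio_inf[of "dvisit P g ?star mu" s mu] mu0[of s] g
    by (simp add: R_def dvisit_occd[OF is_policy_det] field_simps)
  have R0: "0 < R"
  proof -
    fix s
    have "mu s \<le> R / (1 - g) * mu s"
      using occd_ge[of ?star mu s, OF is_policy_det mu0(2)] occ_R[of s] by linarith
    then have "0 < R / (1 - g) * mu s" using mu0(1)[of s] by linarith
    then show ?thesis using mu0(1)[of s] g by (simp add: zero_less_mult_iff zero_less_divide_iff)
  qed
  \<comment> \<open>The rate is the ascent factor \<open>eta / 2\<close> divided by the gradient
    domination constant \<open>R / (1 - g) / c * sqrt S\<close>. Each of the two contributes one
    \<open>1 / sqrt S\<close>, whence \<open>1 / S\<close>.\<close>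
  have C: "C = eta / 2 * ((1 - g) * c / (R * sqrt S))"
  proof -
    define q where "q = sqrt S"
    have q: "S = q * q" using S by (simp add: q_def)
    have "12 * (1 - g) + 16 * (Cinf - (1 - g)) = (1 - g) * (4 * m)" unfolding m_def by (simp add: Ck algebra_simps)
    then have "C = (1 - g)\<^sup>2 * c / ((1 - g) * (4 * m)) * (1 / S) * inverse R"
      by (simp add: C_def S_def R_def)
    also have "(1 - g)\<^sup>2 * c / ((1 - g) * (4 * m)) = (1 - g) * c / (4 * m)"
      using g by (simp add: power2_eq_square)
    finally have "C = (1 - g) * c / (4 * m) * (1 / (q * q)) * inverse R" unfolding q .
    then show ?thesis unfolding eta q_def[symmetric] by (simp add: divide_simps mult_ac)
  qed
  have contract: "gap (Suc t) \<le> exp (- C) * gap t" if t: "1 \<le> t" for t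
  proof -
    have gap0: "0 \<le> gap t"
      unfolding gap_def Vdist_def using pistar_opt is_policy_softmax[of "theta t"]
      by (auto simp flip: sum_subtractf right_diff_distrib intro!: sum_nonneg mult_nonneg_nonneg mu0)
    have "gap t \<le> R / (1 - g) / c * (sqrt S * l2norm (?G t))"
      unfolding gap_def S_def using c0 R0 g cle[OF t] occ_R mu0 by (intro pgrad_Lojasiewicz) auto
    then have "(1 - g) * c / (R * sqrt S) * gap t \<le> l2norm (?G t)"
      using g c0 R0 S by (simp add: field_simps)
    then have "eta / 2 * ((1 - g) * c / (R * sqrt S) * gap t) \<le> eta / 2 * l2norm (?G t)"
      using eta0 by (intro mult_left_mono) auto
    also have "\<dots> \<le> gap t - gap (Suc t)" using asc[OF t] by (simp add: gap_def)
    finally have "C * gap t \<le> gap t - gap (Suc t)" by (simp only: C mult.assoc)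
    moreover have "(1 - C) * gap t \<le> exp (- C) * gap t"
      using exp_ge_add_one_self[of "- C"] gap0 by (intro mult_right_mono) auto
    ultimately show ?thesis by (simp add: algebra_simps)
  qed
  have gap: "gap t \<le> gap 1 * exp (- C * (real t - 1))" if "1 \<le> t" for t
    using that
  proof (induction rule: dec_induct)
    case (step n)
    have "gap (Suc n) \<le> exp (- C) * (gap 1 * exp (- C * (real n - 1)))"
      by (rule order.trans[OF contract[OF step(1)] mult_left_mono[OF step(3)]]) simp
    also have "\<dots> = gap 1 * (exp (- C) * exp (- C * (real n - 1)))" by simp
    also have "exp (- C) * exp (- C * (real n - 1)) = exp (- C * (real (Suc n) - 1))"
      by (simp add: exp_add[symmetric] algebra_simps)
    finally show ?case .
  qed simp
  have occ_C: "occd pol rho u \<le> Cinf' / (1 - g) * mu u" if "is_policy pol" for pol u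
    using occd_le_SUP_ratio[OF that rho, of mu] mu0 by (simp add: Cinf'_def)
  have C'0: "0 \<le> Cinf' / (1 - g)"
  proof -
    fix u
    have "0 \<le> occd ?star rho u"
      using occd_ge[OF is_policy_det, of rho u] rho by (auto simp: is_distr_def intro: order.trans)
    then have "0 \<le> Cinf' / (1 - g) * mu u" using occ_C[OF is_policy_det, of astar u] by linarith
    then show ?thesis using mu0(1)[of u] by (simp only: zero_le_mult_iff) auto
  qed
  \<comment> \<open>Here the performance difference is taken with the occupancy of the current
    policy and the action gaps of the optimal one. These are nonnegative, so the occupancy from
    \<open>rho\<close> can be replaced termwise by a multiple of that from
    \<open>mu\<close>.\<close>
  have rho_gap: "Vdist P r g ?star rho - Vdist P r g (softmax (theta t)) rho \<le> Cinf' / (1 - g) * gap t" for t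
  proof -
    let ?p = "softmax (theta t)"
    let ?h = "\<lambda>u. \<Sum>a\<in>UNIV. ?p u a * (Vfun P r g ?star u - Qfun P r g ?star u a)"
    have diff: "Vdist P r g ?star nu - Vdist P r g ?p nu = (\<Sum>u\<in>UNIV. occd ?p nu u * ?h u)" for nu
    proof -
      have "?h u = - (\<Sum>a\<in>UNIV. ?p u a * (Qfun P r g ?star u a - Vfun P r g ?star u))" for u
        by (simp add: sum_negf[symmetric] algebra_simps)
      then show ?thesis
        using Vdist_difference[OF is_policy_softmax[of "theta t"] is_policy_det[of astar], of r nu]
        by (simp add: sum_negf)
    qed
    have h0: "0 \<le> ?h u" for u
    proof (intro sum_nonneg mult_nonneg_nonneg)
      fix a
      show "0 \<le> Vfun P r g ?star u - Qfun P r g ?star u a"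
        using unique by (cases "a = astar u") (auto simp: Vfun_det less_imp_le)
    qed (simp add: softmax_pos less_imp_le)
    have "(\<Sum>u\<in>UNIV. occd ?p rho u * ?h u) \<le> (\<Sum>u\<in>UNIV. (Cinf' / (1 - g) * occd ?p mu u) * ?h u)"
    proof (intro sum_mono mult_right_mono h0)
      fix u
      have "Cinf' / (1 - g) * mu u \<le> Cinf' / (1 - g) * occd ?p mu u"
        using C'0 mu0 by (intro mult_left_mono occd_ge is_policy_softmax) auto
      then show "occd ?p rho u \<le> Cinf' / (1 - g) * occd ?p mu u" using occ_C[OF is_policy_softmax] order.trans by blast
    qed
    also have "\<dots> = Cinf' / (1 - g) * gap t"
      unfolding gap_def diff by (simp add: sum_distrib_left mult_ac)
    finally show ?thesis unfolding diff .
  qed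
  have "Vdist P r g ?star rho - Vdist P r g (softmax (theta t)) rho \<le> gap 1 * Cinf' / (1 - g) * exp (- C * (real t - 1))"
    if "1 \<le> t" for t
    using rho_gap[of t] mult_left_mono[OF gap[OF that] C'0] by (simp add: mult_ac)
  then show ?thesis using c0 by (simp add: gap_def)
qed

end
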